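(* Let $\lambda\vdash n$ be a partition with $\ell(\lambda)=n-k$ parts, and let $F_\lambda(q)$ be the number of $n\times n$ upper-triangular nilpotent matrices over $\mathbb{F}_q$ of Jordan type $\lambda$. Then $$F_\lambda(q)=\sum_{C\in\mathcal{C}(\lambda)}F_C(q)=(q-1)^{n-\ell(\lambda)}\sum_{C\in\mathcal{C}(\lambda)}q^{\mathrm{ne}(C)},$$ where $\mathcal{C}(\lambda)$ is the set of rook placements on the staircase board $B_n$ of partition type $\lambda$.
   Context: Upper-triangular nilpotent matrices are the strictly upper-triangular ones. A nilpotent $n\times n$ matrix $X$ over $\mathbb{F}_q$ has Jordan type $\lambda=(\lambda_1\ge\cdots\ge\lambda_r>0)\vdash n$ if it is similar to $J_{\lambda_1}\oplus\cdots\oplus J_{\lambda_r}$, where $J_i$ is the $i\times i$ Jordan block with eigenvalue $0$. Here $n\ge1$ and $q$ is a prime power in the formula (the weights below are polynomials in $q$). Rook placements. $B_n$ is the staircase board $\{(i,j):1\le i<j\le n\}$ inside the $n\times n$ grid, squares indexed as matrix entries (row $i$ from the top, column $j$ from the left). $\mathcal{C}(B_n,k)$ is the set of placements of $k$ rooks on squares of $B_n$ with at most one rook in each row and each column. A square of $B_n$ is a north-east square of $C$ if it is not occupied by a rook and lies directly north of a rook (same column, above) or directly east of a rook (same row, to the right). $\mathrm{ne}(C)$ is the number of north-east squares of $C$, and $\mathrm{ne}(C_i)$ the number of those in column $i$. The weight of the $i$th column is $C_i(q)=(q-1)^{\#\text{rooks in column } i}\,q^{\mathrm{ne}(C_i)}$,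 and the weight of $C$ is $F_C(q)=\prod_{i=1}^n C_i(q)$. The multigraph $\mathcal{Z}$. For a partition $\mu$, $|\mu|$ is its size, $\ell(\mu)$ its number of positive parts and $\mu'_j$ the size of the $j$th column of its Ferrers diagram. The vertices of $\mathcal{Z}$ are all partitions (including $\emptyset$). There are edges from $\mu$ to $\lambda$ only if $\lambda$ is obtained from $\mu$ by adding one box; if this box is in column $j$: when $j=1$ there is exactly one edge, with weight $q^{|\mu|-\mu'_1}$; when $j\ge2$ there are $\mu'_{j-1}-\mu'_j$ edges, with weights $(q-1)q^{|\mu|-r}$ for $r=\mu'_j+1,\ldots,\mu'_{j-1}$ (one edge for each $r$). A path is a sequence of consecutive edges (parallel edges are distinguished). Partition type. For each $C\in\mathcal{C}(B_n,k)$ there is a unique path $\Phi(C)$ in $\mathcal{Z}$ starting at $\emptyset$, with $n$ edges, whose sequence of edge weights (as polynomials in $q$) is $(C_1(q),\ldots,C_n(q))$; its endpoint is a partition of $n$ with $n-k$ parts. The partition type of $C$ is the endpoint of $\Phi(C)$. *)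

theory Defs
  imports "HOL-Library.Cardinality" "Jordan_Normal_Form.Jordan_Normal_Form" "Graph_Theory.Arc_Walk"
begin

text \<open>A partition is the weakly decreasing list of its positive parts, so that \<open>length\<close> is the
  number of parts and \<open>sum_list\<close> the size.\<close>

definition is_partition :: "nat list \<Rightarrow> bool" where
  "is_partition \<mu> \<longleftrightarrow> sorted_wrt (\<ge>) \<mu> \<and> 0 \<notin> set \<mu>"

definition partition_of :: "nat list \<Rightarrow> nat \<Rightarrow> bool" where
  "partition_of \<mu> n \<longleftrightarrow> is_partition \<mu> \<and> sum_list \<mu> = n"

text \<open>Rows and columns of Ferrers diagrams are numbered from 1.\<close>

definition ferrers :: "nat list \<Rightarrow> (nat \<times> nat) set" where
  "ferrers \<mu> = {(i, j). 1 \<le> i \<and> i \<le> length \<mu> \<and> 1 \<le> j \<and> j \<le> \<mu> ! (i - 1)}"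

definition col_size :: "nat list \<Rightarrow> nat \<Rightarrow> nat" where
  "col_size \<mu> j = card {i. (i, j) \<in> ferrers \<mu>}"

definition adds_box_in_col :: "nat list \<Rightarrow> nat list \<Rightarrow> nat \<Rightarrow> bool" where
  "adds_box_in_col \<mu> \<nu> j \<longleftrightarrow>
     (\<exists>i. (i, j) \<notin> ferrers \<mu> \<and> ferrers \<nu> = insert (i, j) (ferrers \<mu>))"

text \<open>An edge is a tuple \<open>(\<mu>, \<nu>, j, r)\<close>: source, target, column of the added box, and a label \<open>r\<close>
  distinguishing parallel edges. For \<open>j = 1\<close> there is a single edge; giving it the label
  \<open>r = \<mu>'\<^sub>1\<close> makes the exponent of \<open>q\<close> in the weight equal to \<open>|\<mu>| - r\<close> for every edge.\<close>

type_synonym Z_edge = "nat list \<times> nat list \<times> nat \<times> nat"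

definition Z_edges :: "Z_edge set" where
  "Z_edges = {(\<mu>, \<nu>, j, r).
     is_partition \<mu> \<and> is_partition \<nu> \<and> adds_box_in_col \<mu> \<nu> j \<and>
     (if j = 1 then r = col_size \<mu> 1
      else col_size \<mu> j + 1 \<le> r \<and> r \<le> col_size \<mu> (j - 1))}"

definition Z_graph :: "(nat list, Z_edge) pre_digraph" where
  "Z_graph = \<lparr>verts = {\<mu>. is_partition \<mu>}, arcs = Z_edges,
              tail = (\<lambda>(\<mu>, \<nu>, j, r). \<mu>), head = (\<lambda>(\<mu>, \<nu>, j, r). \<nu>)\<rparr>"

text \<open>Weights are polynomials in the indeterminate \<open>q\<close>. The subtraction in the exponent does not
  truncate, since \<open>r \<le> |\<mu>|\<close> for every edge.\<close>

abbreviation q_poly :: "int poly" where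
  "q_poly \<equiv> [:0, 1:]"

definition edge_weight :: "Z_edge \<Rightarrow> int poly" where
  "edge_weight = (\<lambda>(\<mu>, \<nu>, j, r).
     (if j = 1 then 1 else q_poly - 1) * q_poly ^ (sum_list \<mu> - r))"

definition staircase :: "nat \<Rightarrow> (nat \<times> nat) set" where
  "staircase n = {(i, j). 1 \<le> i \<and> i < j \<and> j \<le> n}"

definition rook_placements :: "nat \<Rightarrow> nat \<Rightarrow> (nat \<times> nat) set set" where
  "rook_placements n k =
     {C. C \<subseteq> staircase n \<and> card C = k \<and> inj_on fst C \<and> inj_on snd C}"

definition ne_squares :: "nat \<Rightarrow> (nat \<times> nat) set \<Rightarrow> (nat \<times> nat) set" where
  "ne_squares n C =
     {(i, j) \<in> staircase n - C. (\<exists>i'. (i', j) \<in> C \<and> i < i') \<or> (\<exists>j'. (i, j') \<in> C \<and> j' < j)}"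

definition ne :: "nat \<Rightarrow> (nat \<times> nat) set \<Rightarrow> nat" where
  "ne n C = card (ne_squares n C)"

definition ne_col :: "nat \<Rightarrow> (nat \<times> nat) set \<Rightarrow> nat \<Rightarrow> nat" where
  "ne_col n C i = card {s \<in> ne_squares n C. snd s = i}"

definition col_weight :: "nat \<Rightarrow> (nat \<times> nat) set \<Rightarrow> nat \<Rightarrow> int poly" where
  "col_weight n C i = (q_poly - 1) ^ card {s \<in> C. snd s = i} * q_poly ^ ne_col n C i"

definition rook_weight :: "nat \<Rightarrow> (nat \<times> nat) set \<Rightarrow> int poly" where
  "rook_weight n C = (\<Prod>i = 1..n. col_weight n C i)"

text \<open>The path \<open>\<Phi>(C)\<close>, and its endpoint. The path exists and is unique for every rook placement
  \<open>C\<close> on the staircase board; comparing weights as polynomials (not at a value of \<open>q\<close>) is essential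
  for uniqueness, since at \<open>q = 2\<close> the factor \<open>q - 1\<close> disappears.\<close>

definition rook_path :: "nat \<Rightarrow> (nat \<times> nat) set \<Rightarrow> Z_edge list" where
  "rook_path n C = (THE p. (\<exists>\<nu>. pre_digraph.awalk Z_graph [] p \<nu>) \<and> length p = n \<and>
     map edge_weight p = map (col_weight n C) [1..<n + 1])"

definition partition_type :: "nat \<Rightarrow> (nat \<times> nat) set \<Rightarrow> nat list" where
  "partition_type n C = last (pre_digraph.awalk_verts Z_graph [] (rook_path n C))"

definition placements_of_type :: "nat \<Rightarrow> nat list \<Rightarrow> (nat \<times> nat) set set" where
  "placements_of_type n \<mu> = {C \<in> (\<Union>k. rook_placements n k). partition_type n C = \<mu>}"

definition nilpotent_mat :: "'a::semiring_1 mat \<Rightarrow> bool" where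
  "nilpotent_mat A \<longleftrightarrow> (\<exists>m. A ^\<^sub>m m = 0\<^sub>m (dim_row A) (dim_row A))"

definition ut_nilpotent_of_type :: "nat \<Rightarrow> nat list \<Rightarrow> 'a::field mat set" where
  "ut_nilpotent_of_type n \<mu> =
     {A \<in> carrier_mat n n. upper_triangular A \<and> nilpotent_mat A \<and>
        jordan_nf A (map (\<lambda>m. (m, 0)) \<mu>)}"

end

(*
Write a strictly upper triangular matrix of size n + 1 as the matrix A of size n extended by a last
column v. If A has Jordan type mu, then the type of the extension arises from mu by adding a box in
column j, where j >= 1 is least with v in im A + ker A^(j-1), and these subspaces have q^(n - mu'_j)
elements. So every out-edge of mu in the multigraph contributes exactly its weight to the number of
choices of v. On the other side, a rook placement of type mu on n columns has as many extensions to
n + 1 columns as mu has out-edges, and the weight of the new column runs exactly once through the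
weights of the out-edges. Hence both sides of the claim are equal to the total weight of the paths
of length n from the empty partition to lambda.
*)

theory Submission
  imports Defs "Jordan_Normal_Form.Matrix_Kernel" "Jordan_Normal_Form.Jordan_Normal_Form_Existence"
begin

section \<open>Partitions and the multigraph\<close>

text \<open>No single matrix is matched with a single placement. Both sides are iterates of one
  linear operator on functions of partitions, sending g to the function whose value at mu is the
  weighted sum of g over the targets of the edges leaving mu. Hence the test function
  \<open>g\<close> stays arbitrary in both inductions and becomes the indicator of lambda only at
  the end.

  Jordan bases are never followed through an extension. For type mu, the size of ker A^k is q to the
  number of boxes in the first k columns of mu. These sizes determine mu, so the linear algebra
  reduces to counting fibres. The subspace im A + ker A^k appears because the k + 1st power of the
  extension sends (x, c) to A^(k+1) x + c A^k v: its kernel gains a factor q over ker A^(k+1)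
  exactly if A^k v lies in the image of A^(k+1).

  On the rook side one relation drives the induction: parts and rooks together number n, so the rows
  still free for a rook are as many as the parts of mu.\<close>

lemma downset_eq_atLeastAtMost_card:
  fixes S :: "nat set"
  assumes "finite S" "0 \<notin> S" "\<And>i i'. i \<in> S \<Longrightarrow> 1 \<le> i' \<Longrightarrow> i' \<le> i \<Longrightarrow> i' \<in> S"
  shows "S = {1..card S}"
proof (cases "S = {}")
  case False
  have "S = {1..Max S}"
  proof (intro equalityI subsetI)
    fix i assume "i \<in> S"
    then show "i \<in> {1..Max S}" using assms(1,2) by (cases i) auto
  next
    fix i assume "i \<in> {1..Max S}"
    then show "i \<in> S" using assms(3)[OF Max_in[OF assms(1) False]] by auto
  qed
  then show ?thesis by (metis card_atLeastAtMost diff_Suc_1)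
qed simp

lemma col_size_eq_length_filter:
  assumes "1 \<le> j"
  shows "col_size \<mu> j = length (filter (\<lambda>m. j \<le> m) \<mu>)"
proof -
  have "{i. (i, j) \<in> ferrers \<mu>} = Suc ` {i. i < length \<mu> \<and> j \<le> \<mu> ! i}"
    using assms by (auto simp: ferrers_def image_iff) (metis Suc_pred diff_Suc_1 le_simps(3))
  then show ?thesis
    by (simp add: col_size_def length_filter_conv_card card_image)
qed

text \<open>In this form facts about columns follow by induction over the list of parts, and
  \<open>sum_list_map_add_box\<close> applies to them.\<close>

lemma col_size_eq_sum_list:
  assumes "1 \<le> j"
  shows "col_size \<mu> j = (\<Sum>m\<leftarrow>\<mu>. of_bool (j \<le> m))"
  unfolding col_size_eq_length_filter[OF assms] by (induction \<mu>) auto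

lemma col_size_one:
  assumes "is_partition \<mu>"
  shows "col_size \<mu> 1 = length \<mu>"
proof -
  have "filter (\<lambda>m. 1 \<le> m) \<mu> = \<mu>"
    using assms by (auto simp: is_partition_def filter_id_conv Suc_le_eq intro: ccontr)
  then show ?thesis by (simp add: col_size_eq_length_filter)
qed

lemma col_size_antimono:
  assumes "1 \<le> i" "i \<le> j"
  shows "col_size \<mu> j \<le> col_size \<mu> i"
  using assms by (induction \<mu>) (auto simp: col_size_eq_sum_list)

lemma length_le_sum_list:
  assumes "is_partition \<mu>"
  shows "length \<mu> \<le> sum_list \<mu>"
proof -
  have "0 \<notin> set \<mu>" using assms by (simp add: is_partition_def)
  then show ?thesis by (induction \<mu>) auto
qed

lemma col_size_le_sum_list:
  assumes "is_partition \<mu>" "1 \<le> j"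
  shows "col_size \<mu> j \<le> sum_list \<mu>"
  using col_size_antimono[of 1 j \<mu>] length_le_sum_list[of \<mu>] assms col_size_one[of \<mu>] by linarith

lemma col_size_eq_0:
  assumes "sum_list \<mu> < j"
  shows "col_size \<mu> j = 0"
proof -
  have "m < j" if "m \<in> set \<mu>" for m
    using member_le_sum_list[OF that] assms by simp
  then show ?thesis using assms by (subst col_size_eq_length_filter) (auto simp: not_le filter_empty_conv)
qed

lemma finite_ferrers_col: "finite {i. (i, j) \<in> ferrers \<mu>}"
  by (rule finite_subset[of _ "{..length \<mu>}"]) (auto simp: ferrers_def)

text \<open>Weakly decreasing parts make every column of the diagram an initial segment of the rows.
  The diagram is therefore known once its column sizes are.\<close>

lemma mem_ferrers_iff:
  assumes "is_partition \<mu>"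
  shows "(i, j) \<in> ferrers \<mu> \<longleftrightarrow> 1 \<le> i \<and> 1 \<le> j \<and> i \<le> col_size \<mu> j"
proof (cases "1 \<le> j")
  case True
  have "{i. (i, j) \<in> ferrers \<mu>} = {1..card {i. (i, j) \<in> ferrers \<mu>}}"
  proof (rule downset_eq_atLeastAtMost_card[OF finite_ferrers_col])
    fix i i' assume "i \<in> {i. (i, j) \<in> ferrers \<mu>}" "1 \<le> i'" "i' \<le> i"
    moreover from this have "\<mu> ! (i - 1) \<le> \<mu> ! (i' - 1)"
      using assms by (cases "i' = i") (auto simp: is_partition_def ferrers_def sorted_wrt_iff_nth_less)
    ultimately show "i' \<in> {i. (i, j) \<in> ferrers \<mu>}" by (auto simp: ferrers_def)
  qed (auto simp: ferrers_def)
  then show ?thesis unfolding col_size_def using True by auto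
qed (auto simp: ferrers_def)

text \<open>The sum of \<open>min k m\<close> over the parts counts the boxes in the first
  \<open>k\<close> columns. It will be the exponent in the size of ker A^k, so this identity is the
  passage from kernels to column sizes.\<close>

lemma sum_list_min_Suc:
  "(\<Sum>m\<leftarrow>\<mu>. min (Suc k) m) = (\<Sum>m\<leftarrow>\<mu>. min k m) + col_size \<mu> (Suc k)"
  by (subst col_size_eq_sum_list, simp, induction \<mu>) auto

lemma partition_eqI:
  assumes "is_partition \<mu>" "is_partition \<nu>" "\<And>j. 1 \<le> j \<Longrightarrow> col_size \<mu> j = col_size \<nu> j"
  shows "\<mu> = \<nu>"
proof -
  \<comment> \<open>The multiplicity of a part m is mu'_m - mu'_(m+1), written additively to stay
    clear of truncated subtraction.\<close>
  have count_eq: "count (mset \<kappa>) m + col_size \<kappa> (Suc m) = col_size \<kappa> m" if "1 \<le> m" for \<kappa> m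
    using that by (induction \<kappa>) (auto simp: col_size_eq_sum_list)
  have "mset \<mu> = mset \<nu>"
  proof (rule multiset_eqI)
    fix m
    show "count (mset \<mu>) m = count (mset \<nu>) m"
    proof (cases "m = 0")
      case True
      then have "m \<notin># mset \<mu>" "m \<notin># mset \<nu>" using assms(1,2) by (auto simp: is_partition_def)
      then show ?thesis by (metis not_in_iff)
    next
      case False
      then show ?thesis using count_eq[of m \<mu>] count_eq[of m \<nu>] assms(3)[of m] assms(3)[of "Suc m"] by simp
    qed
  qed
  moreover have "sorted (rev \<mu>)" "sorted (rev \<nu>)"
    using assms(1,2) by (auto simp: is_partition_def sorted_wrt_rev)
  ultimately show ?thesis
    by (metis mset_rev properties_for_sort rev_rev_ident)
qed

text \<open>Removes the existential row from the edge condition, so that edges can be handled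
  through column sizes alone.\<close>

lemma adds_box_in_col_iff:
  assumes "is_partition \<mu>" "is_partition \<nu>"
  shows "adds_box_in_col \<mu> \<nu> j \<longleftrightarrow>
    1 \<le> j \<and> (\<forall>k\<ge>1. col_size \<nu> k = col_size \<mu> k + of_bool (k = j))"
proof
  assume "adds_box_in_col \<mu> \<nu> j"
  then obtain i where i: "(i, j) \<notin> ferrers \<mu>" "ferrers \<nu> = insert (i, j) (ferrers \<mu>)"
    unfolding adds_box_in_col_def by blast
  have "(i, j) \<in> ferrers \<nu>" using i(2) by simp
  then have "1 \<le> j" by (simp add: ferrers_def)
  moreover have "col_size \<nu> k = col_size \<mu> k + of_bool (k = j)" for k
  proof -
    have "{i'. (i', k) \<in> ferrers \<nu>} =
        (if k = j then insert i {i'. (i', k) \<in> ferrers \<mu>} else {i'. (i', k) \<in> ferrers \<mu>})"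
      using i(2) by auto
    then show ?thesis
      unfolding col_size_def using i(1) finite_ferrers_col[of k \<mu>] by (cases "k = j") auto
  qed
  ultimately show "1 \<le> j \<and> (\<forall>k\<ge>1. col_size \<nu> k = col_size \<mu> k + of_bool (k = j))" by simp
next
  assume *: "1 \<le> j \<and> (\<forall>k\<ge>1. col_size \<nu> k = col_size \<mu> k + of_bool (k = j))"
  \<comment> \<open>The only possible place for the box is directly below column \<open>j\<close>,
    in row mu'_j + 1.\<close>
  have "(i, k) \<in> ferrers \<nu> \<longleftrightarrow> (i, k) \<in> insert (Suc (col_size \<mu> j), j) (ferrers \<mu>)" for i k
    using * by (cases "k = j") (auto simp: mem_ferrers_iff[OF assms(1)] mem_ferrers_iff[OF assms(2)])
  then have "ferrers \<nu> = insert (Suc (col_size \<mu> j), j) (ferrers \<mu>)" by auto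
  moreover have "(Suc (col_size \<mu> j), j) \<notin> ferrers \<mu>" by (simp add: mem_ferrers_iff[OF assms(1)])
  ultimately show "adds_box_in_col \<mu> \<nu> j" unfolding adds_box_in_col_def by blast
qed

text \<open>For \<open>j = 1\<close> nothing is removed, since \<open>0\<close> is never a part.\<close>

definition add_box :: "nat list \<Rightarrow> nat \<Rightarrow> nat list" where
  "add_box \<mu> j = rev (sort (j # remove1 (j - 1) \<mu>))"

definition can_add_box :: "nat list \<Rightarrow> nat \<Rightarrow> bool" where
  "can_add_box \<mu> j \<longleftrightarrow> j = 1 \<or> 2 \<le> j \<and> j - 1 \<in> set \<mu>"

lemma is_partition_add_box:
  assumes "is_partition \<mu>" "can_add_box \<mu> j"
  shows "is_partition (add_box \<mu> j)"
proof -
  have "sorted_wrt (\<ge>) (add_box \<mu> j)"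
    unfolding add_box_def sorted_wrt_rev by (simp only: sorted_sort)
  moreover have "set (add_box \<mu> j) \<subseteq> insert j (set \<mu>)"
    using set_remove1_subset[of "j - 1" \<mu>]
    by (simp only: add_box_def set_rev set_sort list.set) blast
  then have "0 \<notin> set (add_box \<mu> j)"
    using assms by (auto simp: is_partition_def can_add_box_def)
  ultimately show ?thesis by (simp add: is_partition_def)
qed

text \<open>The box turns a part \<open>j - 1\<close> into a part \<open>j\<close>. For
  \<open>j = 1\<close> the part 0 is not listed, which \<open>f 0 = 0\<close> makes harmless. With
  the identity, \<open>min k\<close> or the indicator of \<open>k \<le> m\<close> as
  \<open>f\<close>, this yields the size, the number of boxes in the first \<open>k\<close> columns,
  and the column sizes.\<close>

lemma sum_list_map_add_box:
  fixes f :: "nat \<Rightarrow> nat"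
  assumes "is_partition \<mu>" "can_add_box \<mu> j" "f 0 = 0"
  shows "(\<Sum>m\<leftarrow>add_box \<mu> j. f m) + f (j - 1) = (\<Sum>m\<leftarrow>\<mu>. f m) + f j"
proof -
  have "(\<Sum>m\<leftarrow>add_box \<mu> j. f m) = (\<Sum>m\<in>#mset (add_box \<mu> j). f m)"
    by (simp only: mset_map[symmetric] sum_mset_sum_list)
  also have "mset (add_box \<mu> j) = add_mset j (mset (remove1 (j - 1) \<mu>))"
    by (simp add: add_box_def)
  also have "(\<Sum>m\<in>#add_mset j (mset (remove1 (j - 1) \<mu>)). f m)
      = f j + (\<Sum>m\<leftarrow>remove1 (j - 1) \<mu>. f m)"
    by (simp only: image_mset_add_mset sum_mset.add_mset mset_map[symmetric] sum_mset_sum_list)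
  finally have "(\<Sum>m\<leftarrow>add_box \<mu> j. f m) = f j + (\<Sum>m\<leftarrow>remove1 (j - 1) \<mu>. f m)" .
  moreover have "(\<Sum>m\<leftarrow>remove1 (j - 1) \<mu>. f m) + f (j - 1) = (\<Sum>m\<leftarrow>\<mu>. f m)"
  proof (cases "j - 1 \<in> set \<mu>")
    case True
    then show ?thesis by (simp add: sum_list_map_remove1 add.commute)
  next
    case False
    then show ?thesis using assms by (auto simp: can_add_box_def remove1_idem)
  qed
  ultimately show ?thesis by simp
qed

lemma sum_list_add_box:
  assumes "is_partition \<mu>" "can_add_box \<mu> j"
  shows "sum_list (add_box \<mu> j) = Suc (sum_list \<mu>)"
  using sum_list_map_add_box[OF assms, of "\<lambda>m. m"] assms(2) by (auto simp: can_add_box_def)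

lemma sum_list_min_add_box:
  assumes "is_partition \<mu>" "can_add_box \<mu> j"
  shows "(\<Sum>m\<leftarrow>add_box \<mu> j. min k m) = (\<Sum>m\<leftarrow>\<mu>. min k m) + of_bool (j \<le> k)"
proof -
  have "min k j = min k (j - 1) + of_bool (j \<le> k)"
    using assms(2) by (auto simp: can_add_box_def min_def)
  then show ?thesis
    using sum_list_map_add_box[OF assms, of "min k"] by simp
qed

lemma col_size_add_box:
  assumes "is_partition \<mu>" "can_add_box \<mu> j" "1 \<le> k"
  shows "col_size (add_box \<mu> j) k = col_size \<mu> k + of_bool (k = j)"
proof -
  have "of_bool (k \<le> j) = of_bool (k \<le> j - 1) + (of_bool (k = j) :: nat)"
    using assms(2,3) by (auto simp: can_add_box_def)
  then show ?thesis
    using sum_list_map_add_box[OF assms(1,2), of "\<lambda>m. of_bool (k \<le> m)"] assms(3)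
    by (simp add: col_size_eq_sum_list)
qed

lemma length_add_box:
  assumes "is_partition \<mu>" "can_add_box \<mu> j"
  shows "length (add_box \<mu> j) = length \<mu> + of_bool (j = 1)"
  using col_size_add_box[OF assms, of 1] col_size_one[OF assms(1)]
    col_size_one[OF is_partition_add_box[OF assms]] by auto

text \<open>If no part equals \<open>j - 1\<close>, the thresholds \<open>j - 1\<close> and
  \<open>j\<close> select the same parts, so the two columns have equal size.\<close>

lemma can_add_box_if_col_size_less:
  assumes "2 \<le> j" "col_size \<mu> j < col_size \<mu> (j - 1)"
  shows "can_add_box \<mu> j"
proof (rule ccontr)
  assume "\<not> can_add_box \<mu> j"
  then have "j - 1 \<notin> set \<mu>" using assms(1) by (simp add: can_add_box_def)
  then have "j \<le> m \<longleftrightarrow> j - 1 \<le> m" if "m \<in> set \<mu>" for m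
    using that by (cases "m = j - 1") auto
  then have "filter (\<lambda>m. j \<le> m) \<mu> = filter (\<lambda>m. j - 1 \<le> m) \<mu>" by (intro filter_cong) auto
  then show False using assms by (simp add: col_size_eq_length_filter)
qed

section \<open>Out-edges of a partition and their weights\<close>

definition out_labels :: "nat list \<Rightarrow> nat \<Rightarrow> nat set" where
  "out_labels \<mu> j =
    (if j = 1 then {length \<mu>} else {col_size \<mu> j + 1..col_size \<mu> (j - 1)})"

definition out_edges :: "nat list \<Rightarrow> Z_edge set" where
  "out_edges \<mu> = {e \<in> Z_edges. fst e = \<mu>}"

lemma can_add_box_if_out_label:
  assumes "1 \<le> j" "r \<in> out_labels \<mu> j"
  shows "can_add_box \<mu> j"
proof (cases "j = 1")
  case False
  then show ?thesis
    using assms can_add_box_if_col_size_less[of j \<mu>] by (auto simp: out_labels_def)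
qed (simp add: can_add_box_def)

text \<open>Column sizes determine a partition, so the column of the box fixes the target and an
  out-edge is merely a pair of a column and a label. This allows summation over the out-edges column
  by column.\<close>

lemma out_edges_eq:
  assumes "is_partition \<mu>"
  shows "out_edges \<mu> = (\<lambda>(j, r). (\<mu>, add_box \<mu> j, j, r)) ` (SIGMA j:{1..Suc (sum_list \<mu>)}. out_labels \<mu> j)"
    (is "_ = ?f ` ?S")
proof (intro equalityI subsetI)
  fix e assume "e \<in> out_edges \<mu>"
  then obtain \<nu> j r where e: "e = (\<mu>, \<nu>, j, r)" and "(\<mu>, \<nu>, j, r) \<in> Z_edges"
    unfolding out_edges_def by (cases e) auto
  then have e: "e = (\<mu>, \<nu>, j, r)" "is_partition \<nu>" "adds_box_in_col \<mu> \<nu> j"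
    "if j = 1 then r = col_size \<mu> 1 else col_size \<mu> j + 1 \<le> r \<and> r \<le> col_size \<mu> (j - 1)"
    unfolding Z_edges_def by (auto split: if_splits)
  have j: "1 \<le> j" "\<And>k. 1 \<le> k \<Longrightarrow> col_size \<nu> k = col_size \<mu> k + of_bool (k = j)"
    using e(3) unfolding adds_box_in_col_iff[OF assms e(2)] by auto
  have r: "r \<in> out_labels \<mu> j"
    using e(4) col_size_one[OF assms] by (auto simp: out_labels_def split: if_splits)
  \<comment> \<open>Beyond column |mu| + 1 the preceding column is empty, which leaves no
    label.\<close>
  have "j \<le> Suc (sum_list \<mu>)"
  proof (rule ccontr)
    assume "\<not> j \<le> Suc (sum_list \<mu>)"
    then have "col_size \<mu> (j - 1) = 0" by (intro col_size_eq_0) simp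
    then show False using e(4) \<open>\<not> j \<le> Suc (sum_list \<mu>)\<close> by (auto split: if_splits)
  qed
  moreover have "\<nu> = add_box \<mu> j"
    using can_add_box_if_out_label[OF j(1) r] j(2) assms e(2)
    by (intro partition_eqI) (auto simp: is_partition_add_box col_size_add_box)
  ultimately show "e \<in> ?f ` ?S" using e(1) j(1) r by auto
next
  fix e assume "e \<in> ?f ` ?S"
  then obtain j r where e: "e = (\<mu>, add_box \<mu> j, j, r)" "1 \<le> j" "r \<in> out_labels \<mu> j" by auto
  have "can_add_box \<mu> j" using can_add_box_if_out_label e by blast
  then show "e \<in> out_edges \<mu>"
    using e assms col_size_one[OF assms]
    by (auto simp: out_edges_def Z_edges_def is_partition_add_box adds_box_in_col_iff
        col_size_add_box out_labels_def split: if_splits)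
qed

lemma sum_out_edges:
  assumes "is_partition \<mu>"
  shows "(\<Sum>e\<in>out_edges \<mu>. F e) =
    (\<Sum>j=1..Suc (sum_list \<mu>). \<Sum>r\<in>out_labels \<mu> j. F (\<mu>, add_box \<mu> j, j, r))"
proof -
  have "finite (out_labels \<mu> j)" for j by (simp add: out_labels_def)
  then show ?thesis
    unfolding out_edges_eq[OF assms]
    by (subst sum.reindex)
      (auto simp: inj_on_def sum.Sigma simp del: sum.cl_ivl_Suc intro!: sum.cong)
qed

lemma out_edge_target:
  assumes "is_partition \<mu>" "(\<kappa>, \<nu>, j, r) \<in> out_edges \<mu>"
  shows "is_partition \<nu>" "sum_list \<nu> = Suc (sum_list \<mu>)" "length \<nu> = length \<mu> + of_bool (j = 1)"
  using assms can_add_box_if_out_label[of j r \<mu>]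
  by (auto simp: out_edges_eq is_partition_add_box sum_list_add_box length_add_box)

text \<open>Column sizes decrease from mu'_1 = \<open>length \<mu>\<close> to 0, so the label ranges
  mu'_j < r <= mu'_(j-1) with j >= 2 tile the interval from 1 to \<open>length \<mu>\<close>. Hence
  the weights leaving mu depend only on its size and its number of parts, both of which can be read
  off from a placement directly.\<close>

definition out_weights :: "nat list \<Rightarrow> int poly set" where
  "out_weights \<mu> = insert (q_poly ^ (sum_list \<mu> - length \<mu>))
    ((\<lambda>r. (q_poly - 1) * q_poly ^ (sum_list \<mu> - r)) ` {1..length \<mu>})"

lemma q_poly_power_eq_iff: "q_poly ^ a = q_poly ^ b \<longleftrightarrow> a = b"
proof
  assume "q_poly ^ a = q_poly ^ b"
  \<comment> \<open>At 3, powers with different exponents differ. The same point serves for the next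
    lemma, since \<open>q_poly - 1\<close> takes the nonzero value 2 there.\<close>
  then have "poly (q_poly ^ a) 3 = poly (q_poly ^ b) 3" by simp
  then show "a = b" by (simp add: poly_power)
qed simp

lemma q_poly_minus_one_mult_power_eq_iff:
  "(q_poly - 1) * q_poly ^ a = (q_poly - 1) * q_poly ^ b \<longleftrightarrow> a = b"
proof
  assume "(q_poly - 1) * q_poly ^ a = (q_poly - 1) * q_poly ^ b"
  then have "poly ((q_poly - 1) * q_poly ^ a) 3 = poly ((q_poly - 1) * q_poly ^ b) 3" by (rule arg_cong)
  then show "a = b" by (simp add: poly_power del: mult_cancel_left)
qed simp

lemma q_poly_power_neq: "q_poly ^ a \<noteq> (q_poly - 1) * q_poly ^ b"
proof
  assume "q_poly ^ a = (q_poly - 1) * q_poly ^ b"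
  \<comment> \<open>At 1 the left side is 1, while the factor \<open>q_poly - 1\<close> makes the
    right side 0.\<close>
  then have "poly (q_poly ^ a) 1 = poly ((q_poly - 1) * q_poly ^ b) 1" by simp
  then show False by (simp add: poly_power)
qed

lemma out_label_bounds:
  assumes "is_partition \<mu>" "2 \<le> j" "r \<in> out_labels \<mu> j"
  shows "1 \<le> r" "r \<le> length \<mu>"
proof -
  have "col_size \<mu> (j - 1) \<le> length \<mu>"
    using assms(2) col_size_antimono[of 1 "j - 1" \<mu>] col_size_one[OF assms(1)] by simp
  then show "1 \<le> r" "r \<le> length \<mu>" using assms(2,3) by (auto simp: out_labels_def)
qed

text \<open>The factor \<open>q_poly - 1\<close> separates \<open>j = 1\<close> from the other
  columns. The exponent returns the label, because r <= \<open>length \<mu>\<close> <= |mu| excludes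
  truncation, and a label lies in the range of only one column j >= 2. This is the source of the
  uniqueness of the path of a placement.\<close>

lemma bij_betw_edge_weight:
  assumes "is_partition \<mu>"
  shows "bij_betw edge_weight (out_edges \<mu>) (out_weights \<mu>)"
proof -
  let ?S = "SIGMA j:{1..Suc (sum_list \<mu>)}. out_labels \<mu> j"
  let ?f = "\<lambda>(j, r). (\<mu>, add_box \<mu> j, j, r)"
  let ?w = "\<lambda>(j, r). (if j = 1 then 1 else q_poly - 1) * q_poly ^ (sum_list \<mu> - r)"
  have w: "edge_weight \<circ> ?f = ?w" by (auto simp: edge_weight_def fun_eq_iff)
  have len: "length \<mu> \<le> sum_list \<mu>" by (rule length_le_sum_list[OF assms])
  have bounds: "1 \<le> r \<and> r \<le> length \<mu>" if "(j, r) \<in> ?S" "j \<noteq> 1" for j r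
    using that out_label_bounds[OF assms, of j r] by auto
  have "inj_on ?w ?S"
  proof (rule inj_onI, clarify, goal_cases)
    case (1 j r j' r')
    have r_eq: "j \<noteq> 1 \<and> j' \<noteq> 1 \<Longrightarrow> r = r'"
      using 1 bounds[of j r] bounds[of j' r'] len
        q_poly_minus_one_mult_power_eq_iff[of "sum_list \<mu> - r" "sum_list \<mu> - r'"]
      by (simp del: mult_cancel_left) linarith
    show ?case
    proof (cases "j = 1 \<or> j' = 1")
      case True
      then have "j = 1 \<and> j' = 1"
        using 1 q_poly_power_neq q_poly_power_neq[symmetric] by (auto split: if_splits)
      then show ?thesis using 1 by (auto simp: out_labels_def)
    next
      case False
      then have "r = r'" using r_eq by simp
      moreover have "\<not> i < i'" if "1 \<le> i" "i \<noteq> 1" "r \<in> out_labels \<mu> i" "i' \<noteq> 1" "r \<in> out_labels \<mu> i'" for i i'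
      proof
        assume "i < i'"
        \<comment> \<open>Labels of the later column \<open>i'\<close> are at most mu'_(i'-1) <=
          mu'_i, while those of column \<open>i\<close> exceed mu'_i.\<close>
        then have "col_size \<mu> (i' - 1) \<le> col_size \<mu> i" using that(1) by (intro col_size_antimono) auto
        then show False using that by (simp add: out_labels_def)
      qed
      then have "\<not> j < j'" "\<not> j' < j" using 1 False \<open>r = r'\<close> by auto
      ultimately show ?thesis by simp
    qed
  qed
  moreover have "?w ` ?S = out_weights \<mu>"
  proof (intro equalityI subsetI)
    fix x assume "x \<in> ?w ` ?S"
    then obtain j r where jr: "(j, r) \<in> ?S" "x = ?w (j, r)" by (elim imageE) auto
    show "x \<in> out_weights \<mu>"
    proof (cases "j = 1")
      case True
      then show ?thesis using jr by (simp add: out_weights_def out_labels_def)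
    next
      case False
      then show ?thesis using jr bounds[OF jr(1)] by (auto simp: out_weights_def)
    qed
  next
    fix x assume "x \<in> out_weights \<mu>"
    then consider "x = q_poly ^ (sum_list \<mu> - length \<mu>)"
      | r where "r \<in> {1..length \<mu>}" "x = (q_poly - 1) * q_poly ^ (sum_list \<mu> - r)"
      by (auto simp: out_weights_def)
    then show "x \<in> ?w ` ?S"
    proof cases
      case 1
      then show ?thesis by (intro image_eqI[of _ _ "(1, length \<mu>)"]) (auto simp: out_labels_def)
    next
      case 2
      \<comment> \<open>The column whose range contains \<open>r\<close>: by minimality the
        preceding column still has at least \<open>r\<close> boxes. It is not column 1, which has
        \<open>length \<mu>\<close> boxes.\<close>
      define j where "j = (LEAST j. 1 \<le> j \<and> col_size \<mu> j < r)"
      have ex: "1 \<le> Suc (sum_list \<mu>) \<and> col_size \<mu> (Suc (sum_list \<mu>)) < r"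
        using 2 col_size_eq_0[of \<mu> "Suc (sum_list \<mu>)"] by simp
      have j: "1 \<le> j" "col_size \<mu> j < r"
        using LeastI[of "\<lambda>j. 1 \<le> j \<and> col_size \<mu> j < r", OF ex] by (auto simp: j_def)
      have "j \<le> Suc (sum_list \<mu>)" unfolding j_def using ex by (rule Least_le)
      moreover have "j \<noteq> 1" using j(2) 2 col_size_one[OF assms] by auto
      moreover have "r \<le> col_size \<mu> (j - 1)"
      proof (rule ccontr)
        assume "\<not> r \<le> col_size \<mu> (j - 1)"
        then have "j \<le> j - 1" unfolding j_def
          using \<open>j \<noteq> 1\<close> j(1) by (intro Least_le) (auto simp: j_def)
        then show False using j(1) by simp
      qed
      ultimately show ?thesis using 2 j
        by (intro image_eqI[of _ _ "(j, r)"]) (auto simp: out_labels_def)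
    qed
  qed
  ultimately have "bij_betw ?w ?S (out_weights \<mu>)" by (simp add: bij_betw_def)
  moreover have "bij_betw ?f ?S (out_edges \<mu>)"
    unfolding out_edges_eq[OF assms] by (auto simp: bij_betw_def inj_on_def)
  ultimately show ?thesis unfolding w[symmetric] by (simp add: bij_betw_comp_iff[symmetric])
qed

section \<open>Rook placements\<close>

text \<open>The total weight of the paths of length \<open>n\<close> from the empty partition, each
  multiplied by \<open>g\<close> at its endpoint. The recursion absorbs the last edge into
  \<open>g\<close>, so that appending a last column, to a matrix or to a placement, is one
  unfolding.\<close>

primrec path_sum :: "int \<Rightarrow> nat \<Rightarrow> (nat list \<Rightarrow> int) \<Rightarrow> int" where
  "path_sum q 0 g = g []"
| "path_sum q (Suc n) g =
    path_sum q n (\<lambda>\<mu>. \<Sum>e\<in>out_edges \<mu>. poly (edge_weight e) q * g (fst (snd e)))"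

definition all_placements :: "nat \<Rightarrow> (nat \<times> nat) set set" where
  "all_placements n = {C. C \<subseteq> staircase n \<and> inj_on fst C \<and> inj_on snd C}"

definition extensions :: "nat \<Rightarrow> (nat \<times> nat) set \<Rightarrow> (nat \<times> nat) set set" where
  "extensions n C = insert C ((\<lambda>i. insert (i, Suc n) C) ` ({1..n} - fst ` C))"

lemma Union_rook_placements: "(\<Union>k. rook_placements n k) = all_placements n"
  by (auto simp: rook_placements_def all_placements_def)

lemma finite_staircase: "finite (staircase n)"
  by (rule finite_subset[of _ "{1..n} \<times> {1..n}"]) (auto simp: staircase_def)

lemma finite_all_placements: "finite (all_placements n)"
  by (rule finite_subset[of _ "Pow (staircase n)"])
    (auto simp: all_placements_def finite_staircase)

lemma finite_placement:
  assumes "C \<in> all_placements n"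
  shows "finite C"
  using assms finite_staircase finite_subset by (auto simp: all_placements_def)

lemma placement_bounds:
  assumes "C \<in> all_placements n" "(i, j) \<in> C"
  shows "1 \<le> i" "i < j" "j \<le> n"
  using assms by (auto simp: all_placements_def staircase_def)

lemma restrict_extension:
  assumes "C \<in> all_placements n" "C' \<in> extensions n C"
  shows "{s \<in> C'. snd s \<le> n} = C"
proof -
  have "snd s \<le> n" if "s \<in> C" for s
    using placement_bounds(3)[OF assms(1), of "fst s" "snd s"] that by simp
  then show ?thesis using assms(2) by (auto simp: extensions_def)
qed

lemma extension_placement:
  assumes C: "C \<in> all_placements n" and C': "C' \<in> extensions n C"
  shows "C' \<in> all_placements (Suc n)"
proof -
  note b = placement_bounds[OF C]
  have C0: "C \<in> all_placements (Suc n)"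
    using C by (auto simp: all_placements_def staircase_def)
  show ?thesis
  proof (cases "C' = C")
    case False
    then obtain i where i: "i \<in> {1..n}" "i \<notin> fst ` C" "C' = insert (i, Suc n) C"
      using C' unfolding extensions_def by blast
    have "Suc n \<notin> snd ` C" using b(3) by force
    then show ?thesis using C0 i
      by (auto simp: all_placements_def staircase_def)
  qed (use C0 in simp)
qed

lemma placement_Suc_cases:
  assumes "C' \<in> all_placements (Suc n)"
  shows "{s \<in> C'. snd s \<le> n} \<in> all_placements n"
    "C' \<in> extensions n {s \<in> C'. snd s \<le> n}"
proof -
  let ?C = "{s \<in> C'. snd s \<le> n}"
  show "?C \<in> all_placements n"
    using assms by (auto simp: all_placements_def staircase_def inj_on_def)
  show "C' \<in> extensions n ?C"
  proof (cases "\<exists>i. (i, Suc n) \<in> C'")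
    case True
    then obtain i where i: "(i, Suc n) \<in> C'" by blast
    have eq: "C' = insert (i, Suc n) ?C"
    proof -
      have "s = (i, Suc n)" if "s \<in> C'" "\<not> snd s \<le> n" for s
      proof -
        have "snd s = Suc n"
          using that placement_bounds(3)[OF assms, of "fst s" "snd s"] by simp
        moreover have "inj_on snd C'" using assms by (simp add: all_placements_def)
        ultimately show ?thesis using inj_onD[of snd C' s "(i, Suc n)"] that(1) i by simp
      qed
      then show ?thesis using i by blast
    qed
    have "i \<in> {1..n} - fst ` ?C"
    proof -
      have "i \<notin> fst ` ?C"
      proof
        assume "i \<in> fst ` ?C"
        then obtain j where j: "(i, j) \<in> C'" "j \<le> n" by auto
        have "inj_on fst C'" using assms by (simp add: all_placements_def)
        then have "(i, j) = (i, Suc n)" using inj_onD[of fst C' "(i, j)" "(i, Suc n)"] i j(1) by simp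
        then show False using j(2) by simp
      qed
      then show ?thesis using placement_bounds[OF assms i] by auto
    qed
    then show ?thesis unfolding extensions_def by (subst eq) blast
  next
    case False
    have "C' = ?C"
    proof -
      have "snd s \<le> n" if "s \<in> C'" for s
        using that False placement_bounds(3)[OF assms, of "fst s" "snd s"]
        by (cases s) (auto simp: le_Suc_eq)
      then show ?thesis by auto
    qed
    then show ?thesis by (simp add: extensions_def)
  qed
qed

lemma finite_extensions: "finite (extensions n C)"
  by (simp add: extensions_def)

text \<open>Deleting the last column recovers the smaller placement, so different placements have
  disjoint sets of extensions.\<close>

lemma sum_all_placements_Suc:
  "(\<Sum>C'\<in>all_placements (Suc n). F C') = (\<Sum>C\<in>all_placements n. \<Sum>C'\<in>extensions n C. F C')"
proof -
  have "all_placements (Suc n) = (\<Union>C\<in>all_placements n. extensions n C)"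
    using placement_Suc_cases extension_placement by (intro equalityI subsetI UN_I) (assumption | blast)+
  moreover have "extensions n C \<inter> extensions n D = {}"
    if "C \<in> all_placements n" "D \<in> all_placements n" "C \<noteq> D" for C D
    using restrict_extension that by blast
  ultimately show ?thesis
    by (simp add: sum.UNION_disjoint finite_all_placements finite_extensions)
qed

section \<open>Column weights of an extended placement\<close>

lemma mem_ne_squares_iff:
  "(a, j) \<in> ne_squares n C \<longleftrightarrow> 1 \<le> a \<and> a < j \<and> j \<le> n \<and> (a, j) \<notin> C \<and>
    ((\<exists>i'. (i', j) \<in> C \<and> a < i') \<or> (\<exists>j'. (a, j') \<in> C \<and> j' < j))"
  by (simp add: ne_squares_def staircase_def)

text \<open>A rook creates north-east squares only in its own column and further right, so a rook in
  column n + 1 cannot affect earlier columns.\<close>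

lemma col_weight_restrict:
  assumes "i \<le> n"
  shows "col_weight (Suc n) C' i = col_weight n {s \<in> C'. snd s \<le> n} i"
proof -
  let ?C = "{s \<in> C'. snd s \<le> n}"
  have "{s \<in> C'. snd s = i} = {s \<in> ?C. snd s = i}" using assms by auto
  moreover have "(a, i) \<in> ne_squares (Suc n) C' \<longleftrightarrow> (a, i) \<in> ne_squares n ?C" for a
    using assms unfolding mem_ne_squares_iff by (simp cong: conj_cong) (meson less_le_trans less_imp_le)
  then have "{s \<in> ne_squares (Suc n) C'. snd s = i} = {s \<in> ne_squares n ?C. snd s = i}"
    by auto
  ultimately show ?thesis unfolding col_weight_def ne_col_def by simp
qed

lemma rook_weight_extension:
  assumes "C \<in> all_placements n" "C' \<in> extensions n C"
  shows "rook_weight (Suc n) C' = rook_weight n C * col_weight (Suc n) C' (Suc n)"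
proof -
  have "col_weight (Suc n) C' i = col_weight n C i" if "i \<in> {1..n}" for i
    using that col_weight_restrict[of i n C'] restrict_extension[OF assms] by simp
  then have "(\<Prod>i=1..n. col_weight (Suc n) C' i) = rook_weight n C"
    unfolding rook_weight_def by (rule prod.cong[OF refl])
  then show ?thesis unfolding rook_weight_def by (subst prod.nat_ivl_Suc') (simp_all add: mult.commute)
qed

text \<open>The north-east squares of an empty last column lie in the rows that already hold a rook,
  one row for each rook.\<close>

lemma col_weight_no_rook:
  assumes "C \<in> all_placements n"
  shows "col_weight (Suc n) C (Suc n) = q_poly ^ card C"
proof -
  note b = placement_bounds[OF assms]
  have no: "(i, Suc n) \<notin> C" for i using b(3)[of i "Suc n"] by auto
  then have "{s \<in> C. snd s = Suc n} = {}" by force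
  then have "card {s \<in> C. snd s = Suc n} = 0" by (simp only: card.empty)
  moreover have "{s \<in> ne_squares (Suc n) C. snd s = Suc n} = (\<lambda>a. (a, Suc n)) ` fst ` C"
  proof -
    have "(a, Suc n) \<in> ne_squares (Suc n) C \<longleftrightarrow> a \<in> fst ` C" for a
    proof
      assume "(a, Suc n) \<in> ne_squares (Suc n) C"
      then obtain j' where "(a, j') \<in> C" using no unfolding mem_ne_squares_iff by blast
      then show "a \<in> fst ` C" by force
    next
      assume "a \<in> fst ` C"
      then obtain j' where j': "(a, j') \<in> C" by auto
      then show "(a, Suc n) \<in> ne_squares (Suc n) C"
        using no b[OF j'] unfolding mem_ne_squares_iff by (auto intro!: exI[of _ j'])
    qed
    then show ?thesis by (auto simp: image_iff)
  qed
  moreover have "card ((\<lambda>a. (a, Suc n)) ` fst ` C) = card C"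
    using assms by (subst card_image) (auto simp: all_placements_def inj_on_def[of "\<lambda>a. (a, _)"] card_image)
  ultimately show ?thesis by (simp add: col_weight_def ne_col_def)
qed

text \<open>Besides the rows that already hold a rook, the free rows above the new rook contribute.
  The exponent is thus \<open>card C\<close> plus the rank of \<open>i\<close> among the free
  rows.\<close>

lemma col_weight_rook:
  assumes C: "C \<in> all_placements n" and i: "i \<in> {1..n} - fst ` C"
  shows "col_weight (Suc n) (insert (i, Suc n) C) (Suc n) =
    (q_poly - 1) * q_poly ^ (card C + card {a \<in> {1..n} - fst ` C. a < i})"
proof -
  note b = placement_bounds[OF C]
  let ?C' = "insert (i, Suc n) C"
  let ?R = "fst ` C \<union> {a \<in> {1..n} - fst ` C. a < i}"
  have no: "(i', Suc n) \<notin> C" for i' using b(3)[of i' "Suc n"] by auto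
  then have "{s \<in> ?C'. snd s = Suc n} = {(i, Suc n)}" by auto
  moreover have "{s \<in> ne_squares (Suc n) ?C'. snd s = Suc n} = (\<lambda>a. (a, Suc n)) ` ?R"
  proof -
    have "(a, Suc n) \<in> ne_squares (Suc n) ?C' \<longleftrightarrow> a \<in> ?R" for a
    proof -
      have "(a, Suc n) \<in> ne_squares (Suc n) ?C' \<longleftrightarrow> 1 \<le> a \<and> a \<le> n \<and> a \<noteq> i \<and> (a < i \<or> a \<in> fst ` C)"
      proof
        assume *: "(a, Suc n) \<in> ne_squares (Suc n) ?C'"
        then have "a < i \<or> a \<in> fst ` C"
          using no unfolding mem_ne_squares_iff by (auto simp: image_iff) force
        then show "1 \<le> a \<and> a \<le> n \<and> a \<noteq> i \<and> (a < i \<or> a \<in> fst ` C)"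
          using * unfolding mem_ne_squares_iff by auto
      next
        assume *: "1 \<le> a \<and> a \<le> n \<and> a \<noteq> i \<and> (a < i \<or> a \<in> fst ` C)"
        have "\<exists>j'. (a, j') \<in> C \<and> j' < Suc n" if a: "a \<in> fst ` C"
        proof -
          from a obtain j' where "(a, j') \<in> C" by auto
          then show ?thesis using b(3)[of a j'] by auto
        qed
        then show "(a, Suc n) \<in> ne_squares (Suc n) ?C'"
          using * no unfolding mem_ne_squares_iff by auto
      qed
      moreover have "1 \<le> a \<and> a \<le> n \<and> a \<noteq> i" if a: "a \<in> fst ` C"
      proof -
        from a obtain j' where "(a, j') \<in> C" by auto
        then show ?thesis using b[of a j'] i a by auto
      qed
      ultimately show ?thesis using i by auto
    qed
    then show ?thesis by auto
  qed
  moreover have "card ((\<lambda>a. (a, Suc n)) ` ?R) = card C + card {a \<in> {1..n} - fst ` C. a < i}"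
  proof -
    have "card ((\<lambda>a. (a, Suc n)) ` ?R) = card ?R" by (rule card_image) (simp add: inj_on_def)
    also have "\<dots> = card (fst ` C) + card {a \<in> {1..n} - fst ` C. a < i}"
      using finite_placement[OF C] by (intro card_Un_disjoint) auto
    also have "card (fst ` C) = card C"
      using C by (intro card_image) (simp add: all_placements_def)
    finally show ?thesis .
  qed
  ultimately show ?thesis by (simp add: col_weight_def ne_col_def)
qed

lemma bij_betw_card_less:
  fixes F :: "nat set"
  assumes "finite F"
  shows "bij_betw (\<lambda>i. card {a \<in> F. a < i}) F {..<card F}"
proof -
  have mono: "card {a \<in> F. a < i} < card {a \<in> F. a < j}" if "i \<in> F" "i < j" for i j
    using assms that by (intro psubset_card_mono) auto
  have inj: "inj_on (\<lambda>i. card {a \<in> F. a < i}) F"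
    using mono by (intro linorder_inj_onI) (auto simp: less_le)
  moreover have "(\<lambda>i. card {a \<in> F. a < i}) ` F \<subseteq> {..<card F}"
    using assms by (auto intro!: psubset_card_mono)
  ultimately show ?thesis
    unfolding bij_betw_def by (simp add: card_image card_subset_eq)
qed

text \<open>There are n - \<open>card C\<close> = \<open>length \<mu>\<close> free rows, and the
  ranks of the rows available to a new rook run from 0 to \<open>length \<mu> - 1\<close>. Placing
  no rook gives the weight of the edge in column 1, since \<open>card C\<close> = |mu| -
  \<open>length \<mu>\<close>.\<close>

lemma bij_betw_col_weight:
  assumes C: "C \<in> all_placements n" and \<mu>: "sum_list \<mu> = n" "length \<mu> + card C = n"
  shows "bij_betw (\<lambda>C'. col_weight (Suc n) C' (Suc n)) (extensions n C) (out_weights \<mu>)"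
proof -
  let ?F = "{1..n} - fst ` C"
  let ?w = "\<lambda>C'. col_weight (Suc n) C' (Suc n)"
  let ?e = "\<lambda>i. insert (i, Suc n) C"
  let ?p = "\<lambda>t. (q_poly - 1) * q_poly ^ (card C + t)"
  have "fst s \<in> {1..n}" if "s \<in> C" for s
    using placement_bounds[OF C, of "fst s" "snd s"] that by auto
  then have "fst ` C \<subseteq> {1..n}" by blast
  then have "card ?F = n - card C"
    using C finite_placement[OF C]
    by (simp add: card_Diff_subset card_image all_placements_def)
  then have card: "card ?F = length \<mu>" using \<mu> by simp
  have w: "?w (?e i) = ?p (card {a \<in> ?F. a < i})" if "i \<in> ?F" for i
    using col_weight_rook[OF C that] .
  have wC: "?w C = q_poly ^ card C" by (rule col_weight_no_rook[OF C])
  have bij: "bij_betw (\<lambda>i. card {a \<in> ?F. a < i}) ?F {..<length \<mu>}"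
    using bij_betw_card_less[of ?F] unfolding card by blast
  have ne: "?w C \<noteq> ?w (?e i)" if "i \<in> ?F" for i
    unfolding wC w[OF that] by (rule q_poly_power_neq)
  have "inj_on ?w (extensions n C)"
    unfolding extensions_def
  proof (rule inj_onI, elim insertE imageE, goal_cases)
    case (4 x y i j)
    then have "card {a \<in> ?F. a < i} = card {a \<in> ?F. a < j}"
      by (simp only: w q_poly_minus_one_mult_power_eq_iff)
    then have "i = j" using bij 4 by (auto simp: bij_betw_def dest: inj_onD)
    then show ?case using 4 by simp
  next
    case (2 x y i)
    then show ?case using ne[of i] by (simp only:)
  next
    case (3 x y i)
    then show ?case using ne[of i, symmetric] by (simp only:)
  qed simp
  moreover have "?w ` extensions n C = out_weights \<mu>"
  proof -
    have 1: "?w ` extensions n C = insert (q_poly ^ card C) ((\<lambda>i. ?p (card {a \<in> ?F. a < i})) ` ?F)"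
      unfolding extensions_def image_insert image_image wC
      by (rule arg_cong[of _ _ "insert _"], rule image_cong[OF refl], rule w)
    have "(\<lambda>i. card {a \<in> ?F. a < i}) ` ?F = {..<length \<mu>}"
      using bij by (simp only: bij_betw_def)
    then have 2: "(\<lambda>i. ?p (card {a \<in> ?F. a < i})) ` ?F = ?p ` {..<length \<mu>}"
      by (metis image_image)
    \<comment> \<open>A row of rank t corresponds to the label r = \<open>length \<mu>\<close> - t,
      because then \<open>card C\<close> + t = |mu| - r.\<close>
    have 3: "{..<length \<mu>} = (\<lambda>r. length \<mu> - r) ` {1..length \<mu>}"
    proof (intro equalityI subsetI)
      fix t assume "t \<in> {..<length \<mu>}"
      then show "t \<in> (\<lambda>r. length \<mu> - r) ` {1..length \<mu>}"
        by (intro image_eqI[of _ _ "length \<mu> - t"]) auto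
    qed auto
    have 4: "?p ` (\<lambda>r. length \<mu> - r) ` {1..length \<mu>} =
        (\<lambda>r. (q_poly - 1) * q_poly ^ (sum_list \<mu> - r)) ` {1..length \<mu>}"
      unfolding image_image
    proof (rule image_cong[OF refl])
      fix r assume "r \<in> {1..length \<mu>}"
      then have "card C + (length \<mu> - r) = sum_list \<mu> - r" using \<mu> by auto
      then show "?p (length \<mu> - r) = (q_poly - 1) * q_poly ^ (sum_list \<mu> - r)" by (simp only:)
    qed
    have 5: "card C = sum_list \<mu> - length \<mu>" using \<mu> by simp
    show ?thesis unfolding out_weights_def 1 2 5[symmetric] 4[symmetric] 3[symmetric] ..
  qed
  ultimately show ?thesis by (simp add: bij_betw_def)
qed

text \<open>Lets the weight of an edge reveal, through the factor \<open>q_poly - 1\<close>, whether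
  its box goes to column 1.\<close>

lemma edge_factor_eq_iff:
  "q_poly ^ a = (if P then 1 else q_poly - 1) * q_poly ^ b \<longleftrightarrow> P \<and> a = b"
  "(q_poly - 1) * q_poly ^ a = (if P then 1 else q_poly - 1) * q_poly ^ b \<longleftrightarrow> \<not> P \<and> a = b"
  by (cases P; simp only: q_poly_power_eq_iff q_poly_power_neq q_poly_power_neq[symmetric]
      q_poly_minus_one_mult_power_eq_iff if_True if_False mult_1 not_False_eq_True
      not_True_eq_False simp_thms)+

section \<open>Walks in the multigraph and partition types\<close>

abbreviation walk_end :: "Z_edge list \<Rightarrow> nat list" where
  "walk_end p \<equiv> last (pre_digraph.awalk_verts Z_graph [] p)"

definition is_rook_walk :: "nat \<Rightarrow> (nat \<times> nat) set \<Rightarrow> Z_edge list \<Rightarrow> bool" where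
  "is_rook_walk n C p \<longleftrightarrow> (\<exists>\<nu>. pre_digraph.awalk Z_graph [] p \<nu>) \<and> length p = n \<and>
     map edge_weight p = map (col_weight n C) [1..<n + 1]"

lemma Z_graph_simps [simp]:
  "tail Z_graph e = fst e" "head Z_graph e = fst (snd e)"
  "arcs Z_graph = Z_edges" "verts Z_graph = {\<mu>. is_partition \<mu>}"
  by (auto simp: Z_graph_def split: prod.split)

lemma cas_snoc:
  "pre_digraph.cas Z_graph u (p @ [e]) v \<longleftrightarrow>
    pre_digraph.cas Z_graph u p (fst e) \<and> v = fst (snd e)"
  by (induction p arbitrary: u) (auto simp: pre_digraph.cas.simps)

lemma cas_iff_last:
  "pre_digraph.cas Z_graph u p v \<Longrightarrow> last (pre_digraph.awalk_verts Z_graph u p) = v"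
  by (induction p arbitrary: u)
    (auto simp: pre_digraph.cas.simps pre_digraph.awalk_verts.simps pre_digraph.awalk_verts_non_Nil)

lemma awalk_snoc:
  "(\<exists>\<nu>. pre_digraph.awalk Z_graph [] (p @ [e]) \<nu>) \<longleftrightarrow>
    (\<exists>\<nu>. pre_digraph.awalk Z_graph [] p \<nu>) \<and> e \<in> out_edges (walk_end p)"
  using cas_iff_last[of "[]" p]
  by (auto simp: pre_digraph.awalk_def cas_snoc out_edges_def)

lemma walk_end_snoc: "walk_end (p @ [e]) = fst (snd e)"
  by (simp add: pre_digraph.awalk_verts_conv)

lemma is_rook_walk_Suc:
  assumes "C \<in> all_placements n" "C' \<in> extensions n C"
  shows "is_rook_walk (Suc n) C' p' \<longleftrightarrow>
    (\<exists>p e. p' = p @ [e] \<and> is_rook_walk n C p \<and> e \<in> out_edges (walk_end p) \<and>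
      edge_weight e = col_weight (Suc n) C' (Suc n))"
proof (cases p' rule: rev_cases)
  case Nil
  then show ?thesis by (simp add: is_rook_walk_def)
next
  case (snoc p e)
  have "col_weight (Suc n) C' i = col_weight n C i" if "i \<in> set [1..<n + 1]" for i
    using that col_weight_restrict[of i n C'] restrict_extension[OF assms] by auto
  then have "map (col_weight (Suc n) C') [1..<n + 1] = map (col_weight n C) [1..<n + 1]"
    by (rule map_cong[OF refl])
  then have "map (col_weight (Suc n) C') [1..<Suc n + 1] =
      map (col_weight n C) [1..<n + 1] @ [col_weight (Suc n) C' (Suc n)]"
    by simp
  then show ?thesis
    unfolding snoc is_rook_walk_def awalk_snoc by auto
qed

text \<open>The weight of each new column belongs to \<open>out_weights\<close> of the partition
  reached so far and is carried by exactly one out-edge, so the walk continues in a unique way. The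
  relation between parts and rooks is part of the induction because
  \<open>bij_betw_col_weight\<close> depends on it.\<close>

lemma ex1_rook_walk:
  assumes "C \<in> all_placements n"
  shows "\<exists>p. (\<forall>p'. is_rook_walk n C p' \<longleftrightarrow> p' = p) \<and> partition_of (walk_end p) n \<and>
    length (walk_end p) + card C = n"
  using assms
proof (induction n arbitrary: C)
  case 0
  then have "C = {}" by (auto simp: all_placements_def staircase_def)
  then show ?case
    by (intro exI[of _ "[]"])
      (auto simp: is_rook_walk_def pre_digraph.awalk_def pre_digraph.cas.simps
        pre_digraph.awalk_verts.simps is_partition_def partition_of_def)
next
  case (Suc n)
  define D where "D = {s \<in> C. snd s \<le> n}"
  have D: "D \<in> all_placements n" and C: "C \<in> extensions n D"
    unfolding D_def using placement_Suc_cases[OF Suc.prems] by auto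
  obtain p where p: "\<And>p'. is_rook_walk n D p' \<longleftrightarrow> p' = p" "partition_of (walk_end p) n"
    "length (walk_end p) + card D = n"
    using Suc.IH[OF D] by auto
  let ?\<mu> = "walk_end p" and ?w = "col_weight (Suc n) C (Suc n)"
  have \<mu>: "is_partition ?\<mu>" "sum_list ?\<mu> = n" using p(2) by (auto simp: partition_of_def)
  have "?w \<in> out_weights ?\<mu>"
    using bij_betw_apply[OF bij_betw_col_weight[OF D \<mu>(2) p(3)] C] .
  then obtain e where e: "\<And>e'. e' \<in> out_edges ?\<mu> \<and> edge_weight e' = ?w \<longleftrightarrow> e' = e"
    using bij_betw_edge_weight[OF \<mu>(1)] unfolding bij_betw_def inj_on_def by (metis imageE)
  then have e_out: "e \<in> out_edges ?\<mu>" "edge_weight e = ?w" by blast+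
  obtain \<kappa> \<nu> j r where e_eq: "e = (\<kappa>, \<nu>, j, r)" by (cases e)
  note \<nu> = out_edge_target[OF \<mu>(1) e_out(1)[unfolded e_eq]]
  \<comment> \<open>A box in column 1 adds a part and comes without a rook. Any other box keeps the
    number of parts and comes with the factor \<open>q_poly - 1\<close>, hence with a new
    rook.\<close>
  have card: "card C = card D + of_bool (j \<noteq> 1)"
  proof (cases "C = D")
    case True
    then have "?w = q_poly ^ card D" using col_weight_no_rook[OF D] by simp
    then have "q_poly ^ card D = (if j = 1 then 1 else q_poly - 1) * q_poly ^ (sum_list \<kappa> - r)"
      using e_out(2) by (simp only: e_eq edge_weight_def prod.case)
    then have "j = 1" unfolding edge_factor_eq_iff by blast
    then show ?thesis using True by simp
  next
    case False
    then obtain i where i: "i \<in> {1..n} - fst ` D" "C = insert (i, Suc n) D"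
      using C unfolding extensions_def by blast
    then have "(q_poly - 1) * q_poly ^ (card D + card {a \<in> {1..n} - fst ` D. a < i})
        = (if j = 1 then 1 else q_poly - 1) * q_poly ^ (sum_list \<kappa> - r)"
      using e_out(2) col_weight_rook[OF D i(1)] by (simp only: e_eq edge_weight_def prod.case)
    then have "j \<noteq> 1" unfolding edge_factor_eq_iff by blast
    moreover have "(i, Suc n) \<notin> D" using placement_bounds(3)[OF D, of i "Suc n"] by auto
    ultimately show ?thesis using i(2) finite_placement[OF D] by simp
  qed
  have walk: "is_rook_walk (Suc n) C p' \<longleftrightarrow> p' = p @ [e]" for p'
    unfolding is_rook_walk_Suc[OF D C] p(1) using e by blast
  have part: "partition_of (walk_end (p @ [e])) (Suc n)"
    unfolding walk_end_snoc e_eq using \<nu>(1,2) \<mu>(2) by (simp add: partition_of_def)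
  have "length (walk_end (p @ [e])) = length ?\<mu> + of_bool (j = 1)"
    unfolding walk_end_snoc e_eq using \<nu>(3) by simp
  then have len: "length (walk_end (p @ [e])) + card C = Suc n"
    using card p(3) by (cases "j = 1") simp_all
  show ?case
    using walk part len by (intro exI[of _ "p @ [e]"] conjI allI)
qed

lemma is_rook_walk_rook_path:
  assumes "C \<in> all_placements n"
  shows "is_rook_walk n C p \<longleftrightarrow> p = rook_path n C"
  using ex1_rook_walk[OF assms] unfolding rook_path_def is_rook_walk_def[symmetric]
  by (metis the_equality)

lemma partition_type_placement:
  assumes "C \<in> all_placements n"
  shows "partition_of (partition_type n C) n" "length (partition_type n C) + card C = n"
proof -
  from ex1_rook_walk[OF assms] obtain p where p: "\<forall>p'. is_rook_walk n C p' \<longleftrightarrow> p' = p"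
    "partition_of (walk_end p) n" "length (walk_end p) + card C = n" by blast
  then have "rook_path n C = p" using is_rook_walk_rook_path[OF assms] by blast
  then show "partition_of (partition_type n C) n" "length (partition_type n C) + card C = n"
    unfolding partition_type_def using p(2,3) by simp_all
qed

lemma partition_type_extension:
  assumes "C \<in> all_placements n" "C' \<in> extensions n C"
  shows "\<exists>e\<in>out_edges (partition_type n C).
    edge_weight e = col_weight (Suc n) C' (Suc n) \<and> partition_type (Suc n) C' = fst (snd e)"
proof -
  have "is_rook_walk (Suc n) C' (rook_path (Suc n) C')"
    unfolding is_rook_walk_rook_path[OF extension_placement[OF assms]] ..
  then show ?thesis
    unfolding is_rook_walk_Suc[OF assms] is_rook_walk_rook_path[OF assms(1)] partition_type_def
    by (auto simp: walk_end_snoc)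
qed

text \<open>Extensions and out-edges are both indexed by the same set of weights, and an extension
  has as its type the target of the edge of equal weight. The sum over weights in the middle joins
  the two sides.\<close>

lemma sum_extensions:
  assumes C: "C \<in> all_placements n"
  shows "(\<Sum>C'\<in>extensions n C. poly (col_weight (Suc n) C' (Suc n)) q * g (partition_type (Suc n) C')) =
    (\<Sum>e\<in>out_edges (partition_type n C). poly (edge_weight e) q * g (fst (snd e)))"
proof -
  let ?\<mu> = "partition_type n C"
  have \<mu>: "is_partition ?\<mu>" "sum_list ?\<mu> = n" "length ?\<mu> + card C = n"
    using partition_type_placement[OF C] by (auto simp: partition_of_def)
  note bij = bij_betw_edge_weight[OF \<mu>(1)]
  \<comment> \<open>The inverse of the weight map makes the target a function of the weight
    alone.\<close>
  define E where "E = inv_into (out_edges ?\<mu>) edge_weight"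
  define G where "G w = poly w q * g (fst (snd (E w)))" for w
  have E: "E (edge_weight e) = e" if "e \<in> out_edges ?\<mu>" for e
    using bij that by (simp add: E_def bij_betw_def)
  have "(\<Sum>C'\<in>extensions n C. poly (col_weight (Suc n) C' (Suc n)) q * g (partition_type (Suc n) C')) =
      (\<Sum>C'\<in>extensions n C. G (col_weight (Suc n) C' (Suc n)))"
  proof (rule sum.cong)
    fix C' assume "C' \<in> extensions n C"
    from partition_type_extension[OF C this] obtain e where "e \<in> out_edges ?\<mu>"
      "edge_weight e = col_weight (Suc n) C' (Suc n)" "partition_type (Suc n) C' = fst (snd e)"
      by blast
    then show
      "poly (col_weight (Suc n) C' (Suc n)) q * g (partition_type (Suc n) C') =
        G (col_weight (Suc n) C' (Suc n))"
      using E[of e] by (simp add: G_def)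
  qed simp
  also have "\<dots> = (\<Sum>w\<in>out_weights ?\<mu>. G w)"
    by (rule sum.reindex_bij_betw[OF bij_betw_col_weight[OF C \<mu>(2,3)]])
  also have "\<dots> = (\<Sum>e\<in>out_edges ?\<mu>. G (edge_weight e))"
    by (rule sum.reindex_bij_betw[OF bij, symmetric])
  also have "\<dots> = (\<Sum>e\<in>out_edges ?\<mu>. poly (edge_weight e) q * g (fst (snd e)))"
    by (intro sum.cong refl) (simp add: G_def E)
  finally show ?thesis .
qed

theorem sum_all_placements_eq_path_sum:
  "(\<Sum>C\<in>all_placements n. poly (rook_weight n C) q * g (partition_type n C)) = path_sum q n g"
proof (induction n arbitrary: g)
  case 0
  have "all_placements 0 = {{}}" by (auto simp: all_placements_def staircase_def)
  moreover have "partition_type 0 {} = []"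
    using partition_type_placement(2)[of "{}" 0] by (simp add: all_placements_def)
  ultimately show ?case by (simp add: rook_weight_def)
next
  case (Suc n)
  have "(\<Sum>C'\<in>all_placements (Suc n). poly (rook_weight (Suc n) C') q * g (partition_type (Suc n) C')) =
      (\<Sum>C\<in>all_placements n. \<Sum>C'\<in>extensions n C. poly (rook_weight n C) q *
        (poly (col_weight (Suc n) C' (Suc n)) q * g (partition_type (Suc n) C')))"
    unfolding sum_all_placements_Suc
    by (intro sum.cong refl) (simp add: rook_weight_extension)
  also have "\<dots> = path_sum q (Suc n) g"
    unfolding path_sum.simps Suc.IH[symmetric]
    by (intro sum.cong refl) (simp only: sum_distrib_left[symmetric] sum_extensions)
  finally show ?case .
qed

lemma card_eq_sum_card_snd:
  assumes "finite S" "\<And>s. s \<in> S \<Longrightarrow> snd s \<in> {1..n}"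
  shows "card S = (\<Sum>i=1..n. card {s \<in> S. snd s = (i::nat)})"
  using sum.group[of S "{1..n}" snd "\<lambda>_. 1 :: nat"] assms by (auto simp: image_subset_iff)

lemma rook_weight_eq:
  assumes "C \<in> all_placements n"
  shows "rook_weight n C = (q_poly - 1) ^ card C * q_poly ^ ne n C"
proof -
  have "finite (ne_squares n C)"
    by (rule finite_subset[OF _ finite_staircase[of n]]) (auto simp: ne_squares_def)
  moreover have "snd s \<in> {1..n}" if "s \<in> ne_squares n C" for s
    using that by (auto simp: ne_squares_def staircase_def)
  moreover have "snd s \<in> {1..n}" if "s \<in> C" for s
    using that assms by (auto simp: all_placements_def staircase_def)
  ultimately have "card C = (\<Sum>i=1..n. card {s \<in> C. snd s = i})"
    and "ne n C = (\<Sum>i=1..n. ne_col n C i)"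
    unfolding ne_def ne_col_def
    by (intro card_eq_sum_card_snd finite_placement[OF assms]; blast)+
  then show ?thesis
    by (simp only: rook_weight_def col_weight_def prod.distrib power_sum)
qed

section \<open>Jordan types and kernels of powers\<close>

lemma card_image_mult_card_fibre:
  assumes "finite X" "\<And>y. y \<in> f ` X \<Longrightarrow> card {x \<in> X. f x = y} = c"
  shows "card X = card (f ` X) * c"
proof -
  have "card X = (\<Sum>y\<in>f ` X. card {x \<in> X. f x = y})"
    using sum.group[of X "f ` X" f "\<lambda>_. 1 :: nat"] assms(1) by simp
  also have "\<dots> = card (f ` X) * c" using assms(2) by simp
  finally show ?thesis .
qed

lemma card_carrier_vec: "card (carrier_vec n :: 'a::finite vec set) = CARD('a) ^ n"
proof -
  have "bij_betw list_of_vec (carrier_vec n :: 'a vec set) {xs. set xs \<subseteq> UNIV \<and> length xs = n}"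
    by (rule bij_betw_byWitness[where f' = vec_of_list]) (auto simp: vec_list list_vec intro: carrier_vecI)
  then show ?thesis using card_lists_length_eq[of "UNIV :: 'a set" n] by (simp add: bij_betw_same_card)
qed

lemma finite_carrier_vec [simp]: "finite (carrier_vec n :: 'a::finite vec set)"
  by (rule card_ge_0_finite) (simp add: card_carrier_vec)

lemma card_field_gt_1: "1 < CARD('a::{field, finite})"
proof -
  have "card {0, 1 :: 'a} \<le> CARD('a)" by (rule card_mono) auto
  then show ?thesis by simp
qed

text \<open>Nonempty fibres of a linear map are cosets of its kernel.\<close>

lemma card_mult_mat_vec_fibre:
  fixes A :: "'a::field mat"
  assumes A: "A \<in> carrier_mat nr nc" and w: "w \<in> carrier_vec nc"
  shows "card {x \<in> carrier_vec nc. A *\<^sub>v x = A *\<^sub>v w} = card (mat_kernel A)"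
proof -
  have "bij_betw (\<lambda>x. x + w) (mat_kernel A) {x \<in> carrier_vec nc. A *\<^sub>v x = A *\<^sub>v w}"
  proof (rule bij_betw_byWitness[where f' = "\<lambda>x. x - w"])
    show "\<forall>x\<in>mat_kernel A. x + w - w = x"
      using A w by (auto simp: mat_kernel)
    show "\<forall>x\<in>{x \<in> carrier_vec nc. A *\<^sub>v x = A *\<^sub>v w}. x - w + w = x"
      using w by auto
    show "(\<lambda>x. x + w) ` mat_kernel A \<subseteq> {x \<in> carrier_vec nc. A *\<^sub>v x = A *\<^sub>v w}"
      using A w by (auto simp: mat_kernel mult_add_distrib_mat_vec[OF A])
    show "(\<lambda>x. x - w) ` {x \<in> carrier_vec nc. A *\<^sub>v x = A *\<^sub>v w} \<subseteq> mat_kernel A"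
      using A w by (auto simp: mat_kernel mult_minus_distrib_mat_vec[OF A])
  qed
  then show ?thesis by (simp add: bij_betw_same_card)
qed

text \<open>Rank-nullity, with numbers of elements in place of dimensions.\<close>

lemma card_mat_range_mult_card_mat_kernel:
  fixes A :: "'a::{field, finite} mat"
  assumes A: "A \<in> carrier_mat nr nc"
  shows "card ((\<lambda>x. A *\<^sub>v x) ` carrier_vec nc) * card (mat_kernel A) = CARD('a) ^ nc"
proof -
  have "card (carrier_vec nc :: 'a vec set) =
      card ((\<lambda>x. A *\<^sub>v x) ` carrier_vec nc) * card (mat_kernel A)"
    using card_mult_mat_vec_fibre[OF A] by (intro card_image_mult_card_fibre) auto
  then show ?thesis by (simp add: card_carrier_vec)
qed

lemma card_mat_kernel_similar:
  assumes "similar_mat A B"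
  shows "card (mat_kernel A) = card (mat_kernel B)"
proof -
  obtain P Q where wit: "similar_mat_wit A B P Q" using assms by (auto simp: similar_mat_def)
  define n where "n = dim_row A"
  note w = similar_mat_witD[OF n_def wit]
  have A: "A *\<^sub>v x = P *\<^sub>v (B *\<^sub>v (Q *\<^sub>v x))" if "x \<in> carrier_vec n" for x
    using w that by (simp add: assoc_mult_mat_vec[of _ n n _ n])
  have QP: "Q *\<^sub>v (P *\<^sub>v x) = x" if "x \<in> carrier_vec n" for x
    using w that by (simp add: assoc_mult_mat_vec[of _ n n _ n, symmetric])
  have PQ: "P *\<^sub>v (Q *\<^sub>v x) = x" if "x \<in> carrier_vec n" for x
    using w that by (simp add: assoc_mult_mat_vec[of _ n n _ n, symmetric])
  have "bij_betw (\<lambda>x. Q *\<^sub>v x) (mat_kernel A) (mat_kernel B)"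
  proof (rule bij_betw_byWitness[where f' = "\<lambda>x. P *\<^sub>v x"])
    show "(\<lambda>x. Q *\<^sub>v x) ` mat_kernel A \<subseteq> mat_kernel B"
    proof clarify
      fix x assume "x \<in> mat_kernel A"
      then have x: "x \<in> carrier_vec n" "A *\<^sub>v x = 0\<^sub>v n" using w(4) mat_kernelD by blast+
      have "B *\<^sub>v (Q *\<^sub>v x) = Q *\<^sub>v (A *\<^sub>v x)"
        using A[OF x(1)] QP[of "B *\<^sub>v (Q *\<^sub>v x)"] w x(1) by simp
      also have "\<dots> = 0\<^sub>v n" unfolding x(2) using w by (intro eq_vecI) auto
      finally show "Q *\<^sub>v x \<in> mat_kernel B" using w x by (intro mat_kernelI[of _ n n]) auto
    qed
    show "(\<lambda>x. P *\<^sub>v x) ` mat_kernel B \<subseteq> mat_kernel A"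
    proof clarify
      fix x assume "x \<in> mat_kernel B"
      then have x: "x \<in> carrier_vec n" "B *\<^sub>v x = 0\<^sub>v n" using w(5) mat_kernelD by blast+
      have "A *\<^sub>v (P *\<^sub>v x) = P *\<^sub>v 0\<^sub>v n"
        using A[of "P *\<^sub>v x"] QP[OF x(1)] w x by simp
      also have "\<dots> = 0\<^sub>v n" using w by (intro eq_vecI) auto
      finally show "P *\<^sub>v x \<in> mat_kernel A" using w x by (intro mat_kernelI[of _ n n]) auto
    qed
  qed (use PQ mat_kernelD(1)[OF w(4)] QP mat_kernelD(1)[OF w(5)] in blast)+
  then show ?thesis by (rule bij_betw_same_card)
qed

lemma card_mat_kernel_four_block:
  fixes A B :: "'a::field mat"
  assumes A: "A \<in> carrier_mat n n" and B: "B \<in> carrier_mat m m"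
  shows "card (mat_kernel (four_block_mat A (0\<^sub>m n m) (0\<^sub>m m n) B)) =
    card (mat_kernel A) * card (mat_kernel B)"
proof -
  let ?F = "four_block_mat A (0\<^sub>m n m) (0\<^sub>m m n) B"
  have F: "?F \<in> carrier_mat (n + m) (n + m)" using A B by auto
  have zero: "0\<^sub>v (n + m) = 0\<^sub>v n @\<^sub>v 0\<^sub>v m" by (intro eq_vecI) auto
  have mult: "?F *\<^sub>v (x @\<^sub>v y) = 0\<^sub>v (n + m) \<longleftrightarrow> A *\<^sub>v x = 0\<^sub>v n \<and> B *\<^sub>v y = 0\<^sub>v m"
    if "x \<in> carrier_vec n" "y \<in> carrier_vec m" for x y
    unfolding mult_mat_vec_split[OF A B that] zero
    using mult_mat_vec_carrier[OF A that(1)] by (intro append_vec_eq[of _ n]) auto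
  have "bij_betw (\<lambda>(x, y). x @\<^sub>v y) (mat_kernel A \<times> mat_kernel B) (mat_kernel ?F)"
  proof (rule bij_betw_byWitness[where f' = "\<lambda>z. (vec_first z n, vec_last z m)"])
    show "\<forall>a\<in>mat_kernel A \<times> mat_kernel B.
        (vec_first (case a of (x, y) \<Rightarrow> x @\<^sub>v y) n, vec_last (case a of (x, y) \<Rightarrow> x @\<^sub>v y) m) = a"
      using A B by (auto simp: mat_kernel vec_first_def vec_last_def intro!: eq_vecI)
    show "\<forall>z\<in>mat_kernel ?F. (case (vec_first z n, vec_last z m) of (x, y) \<Rightarrow> x @\<^sub>v y) = z"
      using mat_kernelD[OF F] by simp
    show "(\<lambda>(x, y). x @\<^sub>v y) ` (mat_kernel A \<times> mat_kernel B) \<subseteq> mat_kernel ?F"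
      using A B mult by (auto simp: mat_kernel[OF F] mat_kernel[OF A] mat_kernel[OF B])
    show "(\<lambda>z. (vec_first z n, vec_last z m)) ` mat_kernel ?F \<subseteq> mat_kernel A \<times> mat_kernel B"
    proof (rule image_subsetI)
      fix z assume "z \<in> mat_kernel ?F"
      then have z: "z \<in> carrier_vec (n + m)" "?F *\<^sub>v z = 0\<^sub>v (n + m)" using mat_kernelD[OF F] by auto
      then have "?F *\<^sub>v (vec_first z n @\<^sub>v vec_last z m) = 0\<^sub>v (n + m)" by simp
      then show "(vec_first z n, vec_last z m) \<in> mat_kernel A \<times> mat_kernel B"
        using mult[of "vec_first z n" "vec_last z m"] A B by (simp add: mat_kernel)
    qed
  qed
  then show ?thesis by (simp add: bij_betw_same_card[symmetric] card_cartesian_product)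
qed

text \<open>The \<open>k\<close>-th power shifts coordinates by \<open>k\<close>, so its kernel
  consists of the vectors that vanish from index \<open>k\<close> on. This leaves
  \<open>min k n\<close> free coordinates.\<close>

lemma card_mat_kernel_jordan_block_pow:
  "card (mat_kernel (jordan_block n (0::'a::{field, finite}) ^\<^sub>m k)) = CARD('a) ^ min k n"
proof -
  let ?J = "jordan_block n (0::'a) ^\<^sub>m k"
  have J: "?J \<in> carrier_mat n n" by simp
  have mult: "(?J *\<^sub>v x) $ i = (if i + k < n then x $ (i + k) else 0)"
    if "x \<in> carrier_vec n" "i < n" for x i
  proof -
    have "(?J *\<^sub>v x) $ i = (\<Sum>j\<in>{0..<n}. (if j = i + k then 1 else 0) * x $ j)"
      using that by (auto simp: scalar_prod_def jordan_block_zero_pow intro!: sum.cong)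
    also have "\<dots> = (\<Sum>j\<in>{0..<n}. if j = i + k then x $ j else 0)"
      by (intro sum.cong) auto
    finally show ?thesis by simp
  qed
  have kernel: "mat_kernel ?J = {x \<in> carrier_vec n. \<forall>i<n. k \<le> i \<longrightarrow> x $ i = 0}"
  proof -
    have "?J *\<^sub>v x = 0\<^sub>v n \<longleftrightarrow> (\<forall>i<n. k \<le> i \<longrightarrow> x $ i = 0)" if x: "x \<in> carrier_vec n" for x
    proof
      assume *: "?J *\<^sub>v x = 0\<^sub>v n"
      show "\<forall>i<n. k \<le> i \<longrightarrow> x $ i = 0"
      proof (intro allI impI)
        fix i assume "i < n" "k \<le> i"
        then show "x $ i = 0" using mult[OF x, of "i - k"] * by simp
      qed
    next
      assume "\<forall>i<n. k \<le> i \<longrightarrow> x $ i = 0"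
      then show "?J *\<^sub>v x = 0\<^sub>v n"
        by (intro eq_vecI) (use mult[OF x] in \<open>simp_all del: index_mult_mat_vec\<close>)
    qed
    then show ?thesis unfolding mat_kernel[OF J] by auto
  qed
  have "bij_betw (\<lambda>x. vec (min k n) (\<lambda>i. x $ i)) (mat_kernel ?J) (carrier_vec (min k n))"
    unfolding kernel
    by (rule bij_betw_byWitness[where f' = "\<lambda>y. vec n (\<lambda>i. if i < min k n then y $ i else 0)"])
      (auto intro!: eq_vecI simp: not_less)
  then show ?thesis by (simp add: bij_betw_same_card card_carrier_vec)
qed

lemma card_mat_kernel_jordan_matrix_pow:
  "card (mat_kernel (jordan_matrix (map (\<lambda>m. (m, 0::'a::{field, finite})) \<mu>) ^\<^sub>m k)) =
    CARD('a) ^ (\<Sum>m\<leftarrow>\<mu>. min k m)"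
proof (induction \<mu>)
  case Nil
  have "mat_kernel (0\<^sub>m 0 0 :: 'a mat) = {0\<^sub>v 0}" by (auto simp: mat_kernel[of _ 0 0])
  then show ?case by (simp add: jordan_matrix_pow)
next
  case (Cons m \<mu>)
  let ?J = "jordan_matrix (map (\<lambda>m. (m, 0::'a)) \<mu>)"
  let ?d = "sum_list (map fst (map (\<lambda>m. (m, 0::'a)) \<mu>))"
  have carrier: "?J ^\<^sub>m k \<in> carrier_mat ?d ?d" "jordan_block m (0::'a) ^\<^sub>m k \<in> carrier_mat m m"
    by (intro pow_carrier_mat jordan_matrix_carrier jordan_block_carrier)+
  have "jordan_matrix (map (\<lambda>m. (m, 0::'a)) (m # \<mu>)) ^\<^sub>m k =
      four_block_mat (jordan_block m 0 ^\<^sub>m k) (0\<^sub>m (dim_row (jordan_block m (0::'a) ^\<^sub>m k)) (dim_col (?J ^\<^sub>m k)))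
        (0\<^sub>m (dim_row (?J ^\<^sub>m k)) (dim_col (jordan_block m (0::'a) ^\<^sub>m k))) (?J ^\<^sub>m k)"
    by (simp only: jordan_matrix_pow list.map diag_block_mat.simps prod.case Let_def)
  also have "\<dots> = four_block_mat (jordan_block m 0 ^\<^sub>m k) (0\<^sub>m m ?d) (0\<^sub>m ?d m) (?J ^\<^sub>m k)"
    by (simp only: carrier[THEN carrier_matD(1)] carrier[THEN carrier_matD(2)])
  finally show ?case
    using Cons.IH
    by (simp only: card_mat_kernel_four_block[OF carrier(2,1)] card_mat_kernel_jordan_block_pow
        power_add sum_list.Cons list.map)
qed

text \<open>The exponent is the dimension of ker A^k for Jordan type mu. Kernel sizes stand in for
  the Jordan form because they can be computed for an extended matrix without choosing a
  basis.\<close>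

definition ker_profile :: "'a::{field, finite} mat \<Rightarrow> nat list \<Rightarrow> bool" where
  "ker_profile A \<mu> \<longleftrightarrow> is_partition \<mu> \<and>
    (\<forall>k. card (mat_kernel (A ^\<^sub>m k)) = CARD('a) ^ (\<Sum>m\<leftarrow>\<mu>. min k m))"

text \<open>The field has more than one element, so the exponents are determined. Their consecutive
  differences are the column sizes, by \<open>sum_list_min_Suc\<close>.\<close>

lemma ker_profile_unique:
  fixes A :: "'a::{field, finite} mat"
  assumes "ker_profile A \<mu>" "ker_profile A \<nu>"
  shows "\<mu> = \<nu>"
proof (rule partition_eqI)
  have eq: "(\<Sum>m\<leftarrow>\<mu>. min k m) = (\<Sum>m\<leftarrow>\<nu>. min k m)" for k
  proof -
    have "CARD('a) ^ (\<Sum>m\<leftarrow>\<mu>. min k m) = CARD('a) ^ (\<Sum>m\<leftarrow>\<nu>. min k m)"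
      using assms unfolding ker_profile_def by metis
    then show ?thesis using power_inject_exp[OF card_field_gt_1[where 'a = 'a]] by blast
  qed
  show "col_size \<mu> j = col_size \<nu> j" if "1 \<le> j" for j
    using eq[of "j - 1"] eq[of j] sum_list_min_Suc[of "j - 1" \<mu>] sum_list_min_Suc[of "j - 1" \<nu>] that
    by simp
qed (use assms in \<open>auto simp: ker_profile_def\<close>)

section \<open>Reordering Jordan blocks\<close>

lemma similar_mat_four_block_swap:
  fixes A B :: "'a::field mat"
  assumes A: "A \<in> carrier_mat n n" and B: "B \<in> carrier_mat m m"
  shows "similar_mat (four_block_mat A (0\<^sub>m n m) (0\<^sub>m m n) B) (four_block_mat B (0\<^sub>m m n) (0\<^sub>m n m) A)"
proof -
  \<comment> \<open>The permutation matrix that exchanges the two groups of coordinates;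
    \<open>?Q\<close> is its inverse.\<close>
  let ?P = "four_block_mat (0\<^sub>m n m) (1\<^sub>m n) (1\<^sub>m m) (0\<^sub>m m n) :: 'a mat"
  let ?Q = "four_block_mat (0\<^sub>m m n) (1\<^sub>m m) (1\<^sub>m n) (0\<^sub>m n m) :: 'a mat"
  let ?B = "four_block_mat B (0\<^sub>m m n) (0\<^sub>m n m) A"
  have one: "four_block_mat (1\<^sub>m a) (0\<^sub>m a b) (0\<^sub>m b a) (1\<^sub>m b) = (1\<^sub>m (a + b) :: 'a mat)" for a b
    by (intro eq_matI) auto
  have PQ: "?P * ?Q = 1\<^sub>m (n + m)"
    by (subst mult_four_block_mat[of _ n m _ n _ m _ _ n _ m]) (auto simp: one)
  have QP: "?Q * ?P = 1\<^sub>m (n + m)"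
    by (subst mult_four_block_mat[of _ m n _ m _ n _ _ m _ n]) (auto simp: one add.commute)
  have PB: "?P * ?B = four_block_mat (0\<^sub>m n m) A B (0\<^sub>m m n)"
    using A B by (subst mult_four_block_mat[of _ n m _ n _ m _ _ m _ n]) auto
  have eq: "?P * ?B * ?Q = four_block_mat A (0\<^sub>m n m) (0\<^sub>m m n) B"
    unfolding PB mult_four_block_mat[OF zero_carrier_mat A B zero_carrier_mat
        zero_carrier_mat one_carrier_mat one_carrier_mat zero_carrier_mat]
    using A B by simp
  have sub: "{four_block_mat A (0\<^sub>m n m) (0\<^sub>m m n) B, ?B, ?P, ?Q} \<subseteq> carrier_mat (n + m) (n + m)"
    using A B unfolding carrier_mat_def by auto
  show ?thesis by (rule similar_matI[OF sub PQ QP eq[symmetric]])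
qed

lemma jordan_matrix_append:
  "jordan_matrix (xs @ ys) = four_block_mat (jordan_matrix xs)
    (0\<^sub>m (sum_list (map fst xs)) (sum_list (map fst ys)))
    (0\<^sub>m (sum_list (map fst ys)) (sum_list (map fst xs))) (jordan_matrix ys)"
proof -
  have "jordan_matrix (xs @ ys) = four_block_mat (jordan_matrix xs)
    (0\<^sub>m (dim_row (jordan_matrix xs)) (dim_col (jordan_matrix ys)))
    (0\<^sub>m (dim_row (jordan_matrix ys)) (dim_col (jordan_matrix xs))) (jordan_matrix ys)"
    unfolding jordan_matrix_def by (simp only: map_append diag_block_mat_append Let_def)
  then show ?thesis by simp
qed

lemma similar_jordan_matrix_append:
  fixes xs xs' ys ys' :: "(nat \<times> 'a::field) list"
  assumes "similar_mat (jordan_matrix xs) (jordan_matrix xs')"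
    "similar_mat (jordan_matrix ys) (jordan_matrix ys')"
  shows "similar_mat (jordan_matrix (xs @ ys)) (jordan_matrix (xs' @ ys'))"
proof -
  have dim: "sum_list (map fst xs) = sum_list (map fst xs')" if sim:
    "similar_mat (jordan_matrix xs) (jordan_matrix xs')" for xs xs' :: "(nat \<times> 'a) list"
  proof -
    obtain n where "jordan_matrix xs \<in> carrier_mat n n" "jordan_matrix xs' \<in> carrier_mat n n"
      using similar_matD[OF sim] by blast
    then show ?thesis using carrier_matD(1) jordan_matrix_dim(1) by metis
  qed
  show ?thesis
    using similar_mat_four_block_0_0[OF assms jordan_matrix_carrier jordan_matrix_carrier]
    unfolding jordan_matrix_append dim[OF assms(1)] dim[OF assms(2)] .
qed

text \<open>The existence theorem for Jordan forms yields blocks in no particular order, whereas a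
  partition lists their sizes sorted. It suffices to move one block at a time to the front.\<close>

lemma similar_jordan_matrix_mset:
  fixes xs ys :: "(nat \<times> 'a::field) list"
  assumes "mset xs = mset ys"
  shows "similar_mat (jordan_matrix xs) (jordan_matrix ys)"
  using assms
proof (induction xs arbitrary: ys)
  case Nil
  then show ?case by (auto intro!: similar_mat_refl[of _ 0])
next
  case (Cons x xs)
  have refl: "similar_mat (jordan_matrix zs) (jordan_matrix zs)" for zs :: "(nat \<times> 'a) list"
    by (rule similar_mat_refl[OF jordan_matrix_carrier])
  have "x \<in> set ys" using Cons.prems by (metis list.set_intros(1) set_mset_mset)
  then obtain as bs where ys: "ys = as @ x # bs" by (meson split_list)
  have swap: "similar_mat (jordan_matrix ([x] @ as)) (jordan_matrix (as @ [x]))"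
    unfolding jordan_matrix_append
    by (rule similar_mat_four_block_swap[OF jordan_matrix_carrier jordan_matrix_carrier])
  have "mset xs = mset (as @ bs)" using Cons.prems ys by simp
  then have "similar_mat (jordan_matrix ([x] @ xs)) (jordan_matrix ([x] @ (as @ bs)))"
    by (intro similar_jordan_matrix_append refl Cons.IH)
  moreover have "similar_mat (jordan_matrix (([x] @ as) @ bs)) (jordan_matrix ((as @ [x]) @ bs))"
    by (intro similar_jordan_matrix_append refl swap)
  ultimately show ?case unfolding ys using similar_mat_trans by fastforce
qed

section \<open>Strictly upper triangular matrices and their Jordan types\<close>

definition strict_ut_mats :: "nat \<Rightarrow> 'a::zero mat set" where
  "strict_ut_mats n = {A \<in> carrier_mat n n. \<forall>i<n. \<forall>j\<le>i. A $$ (i, j) = 0}"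

lemma strict_ut_mats_upper_triangular:
  assumes "A \<in> strict_ut_mats n"
  shows "upper_triangular A"
  using assms by (auto simp: strict_ut_mats_def)

lemma char_poly_strict_ut:
  fixes A :: "'a::field mat"
  assumes A: "A \<in> strict_ut_mats n"
  shows "char_poly A = [:0, 1:] ^ n"
proof -
  have c: "A \<in> carrier_mat n n" using A by (simp add: strict_ut_mats_def)
  have "diag_mat A = replicate n 0"
    using A by (intro nth_equalityI) (auto simp: strict_ut_mats_def diag_mat_def)
  then show ?thesis
    using char_poly_upper_triangular[OF c strict_ut_mats_upper_triangular[OF A]] by simp
qed

lemma jordan_nf_if_strict_ut:
  fixes A :: "'a::field mat"
  assumes A: "A \<in> strict_ut_mats n"
  shows "\<exists>\<mu>. is_partition \<mu> \<and> jordan_nf A (map (\<lambda>m. (m, 0)) \<mu>)"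
proof -
  have c: "A \<in> carrier_mat n n" using A by (simp add: strict_ut_mats_def)
  obtain xs where jnf: "jordan_nf A xs"
    using triangular_to_jnf_vector[OF c strict_ut_mats_upper_triangular[OF A]] by blast
  then have nz: "0 \<notin> fst ` set xs" by (simp add: jordan_nf_def)
  \<comment> \<open>The eigenvalue of a block is a root of the characteristic polynomial, which is
    X^n here.\<close>
  have ev: "a = 0" if "(m, a) \<in> set xs" for m a
  proof -
    have "m \<noteq> 0" using nz that by force
    have "poly (char_poly A) a = (\<Prod>(m', b)\<leftarrow>xs. (a - b) ^ m')"
      unfolding jordan_nf_char_poly[OF jnf] by (induction xs) (auto simp: poly_power)
    also have "\<dots> = 0"
      using that \<open>m \<noteq> 0\<close> by (auto simp: prod_list_zero_iff image_iff intro!: bexI[of _ "(m, a)"])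
    finally have "a ^ n = 0" unfolding char_poly_strict_ut[OF A] by (simp add: poly_power)
    then show ?thesis by simp
  qed
  let ?\<mu> = "rev (sort (map fst xs))"
  have "map (\<lambda>m. (m, 0)) (map fst xs) = xs"
    unfolding map_map o_def by (intro map_idI) (use ev in force)
  then have mset: "mset (map (\<lambda>m. (m, 0)) ?\<mu>) = mset xs"
    by (metis mset_map mset_rev mset_sort)
  have nz': "0 \<notin> fst ` set (map (\<lambda>m. (m, 0)) ?\<mu>)"
    unfolding set_map image_image set_rev set_sort using nz by simp
  from mset have "similar_mat (jordan_matrix xs) (jordan_matrix (map (\<lambda>m. (m, 0)) ?\<mu>))"
    by (intro similar_jordan_matrix_mset) simp
  then have "jordan_nf A (map (\<lambda>m. (m, 0)) ?\<mu>)"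
    using similar_mat_trans[of A "jordan_matrix xs"] jnf nz'
    unfolding jordan_nf_def by (intro conjI) simp_all
  moreover have "is_partition ?\<mu>"
    using nz by (simp add: is_partition_def sorted_wrt_rev)
  ultimately show ?thesis by blast
qed

lemma ker_profile_if_jordan_nf:
  fixes A :: "'a::{field, finite} mat"
  assumes "is_partition \<mu>" "jordan_nf A (map (\<lambda>m. (m, 0)) \<mu>)"
  shows "ker_profile A \<mu>"
proof -
  obtain P Q where "similar_mat_wit A (jordan_matrix (map (\<lambda>m. (m, 0)) \<mu>)) P Q"
    using assms(2) by (auto simp: jordan_nf_def similar_mat_def)
  then have "similar_mat (A ^\<^sub>m k) (jordan_matrix (map (\<lambda>m. (m, 0)) \<mu>) ^\<^sub>m k)" for k
    using similar_mat_wit_pow unfolding similar_mat_def by blast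
  then show ?thesis
    using assms(1) card_mat_kernel_similar
    unfolding ker_profile_def card_mat_kernel_jordan_matrix_pow[symmetric] by blast
qed

text \<open>For the backward direction, some Jordan type exists, it is a kernel profile, and
  profiles are unique.\<close>

lemma jordan_nf_iff_ker_profile:
  fixes A :: "'a::{field, finite} mat"
  assumes "A \<in> strict_ut_mats n" "is_partition \<mu>"
  shows "jordan_nf A (map (\<lambda>m. (m, 0)) \<mu>) \<longleftrightarrow> ker_profile A \<mu>"
  using jordan_nf_if_strict_ut[OF assms(1)] ker_profile_if_jordan_nf assms(2) ker_profile_unique
  by metis

text \<open>Each factor pushes the support one diagonal further up: in the product, either
  \<open>l < i + k\<close> kills the left factor or \<open>j \<le> l\<close> kills the right one.
  For \<open>k = n\<close> nothing remains, which gives nilpotency.\<close>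

lemma strict_ut_pow:
  fixes A :: "'a::field mat"
  assumes A: "A \<in> strict_ut_mats n" and "i < n" "j < n" "j < i + k"
  shows "(A ^\<^sub>m k) $$ (i, j) = 0"
  using assms(2-)
proof (induction k arbitrary: i j)
  case 0
  then show ?case using A by (auto simp: strict_ut_mats_def)
next
  case (Suc k)
  have c: "A \<in> carrier_mat n n" using A by (simp add: strict_ut_mats_def)
  have "(A ^\<^sub>m k) $$ (i, l) * A $$ (l, j) = 0" if "l < n" for l
  proof (cases "l < i + k")
    case False
    then show ?thesis using A Suc.prems that by (simp add: strict_ut_mats_def)
  qed (use Suc that in simp)
  then have "(\<Sum>l\<in>{0..<n}. (A ^\<^sub>m k) $$ (i, l) * A $$ (l, j)) = 0"
    by (intro sum.neutral) auto
  moreover have "(A ^\<^sub>m Suc k) $$ (i, j) = (\<Sum>l\<in>{0..<n}. (A ^\<^sub>m k) $$ (i, l) * A $$ (l, j))"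
    using c Suc.prems by (simp add: scalar_prod_def)
  ultimately show ?case by simp
qed

lemma ut_nilpotent_of_type_eq:
  assumes "is_partition \<mu>"
  shows "ut_nilpotent_of_type n \<mu> = {A \<in> strict_ut_mats n :: 'a::{field, finite} mat set. ker_profile A \<mu>}"
proof (intro equalityI subsetI)
  fix A :: "'a mat" assume "A \<in> ut_nilpotent_of_type n \<mu>"
  then have c: "A \<in> carrier_mat n n" and ut: "upper_triangular A"
    and jnf: "jordan_nf A (map (\<lambda>m. (m, 0)) \<mu>)"
    by (auto simp: ut_nilpotent_of_type_def)
  \<comment> \<open>Diagonal entries are roots of the characteristic polynomial, and Jordan blocks
    with eigenvalue 0 make it a power of X.\<close>
  have "A $$ (i, i) = 0" if "i < n" for i
  proof -
    let ?a = "A $$ (i, i)"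
    have "?a \<in> set (diag_mat A)" using c that by (auto simp: diag_mat_def)
    then have "poly (char_poly A) ?a = 0"
      unfolding char_poly_upper_triangular[OF c ut] by (induction "diag_mat A") (auto simp: poly_prod_list prod_list_zero_iff)
    moreover have "poly (char_poly A) ?a = (\<Prod>m\<leftarrow>\<mu>. ?a ^ m)"
      unfolding jordan_nf_char_poly[OF jnf] by (induction \<mu>) (auto simp: poly_power)
    ultimately show ?thesis by (auto simp: prod_list_zero_iff)
  qed
  then have "A \<in> strict_ut_mats n"
    using c ut by (auto simp: strict_ut_mats_def le_less)
  then show "A \<in> {A \<in> strict_ut_mats n. ker_profile A \<mu>}"
    using jnf jordan_nf_iff_ker_profile[OF _ assms] by auto
next
  fix A :: "'a mat" assume "A \<in> {A \<in> strict_ut_mats n. ker_profile A \<mu>}"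
  then have A: "A \<in> strict_ut_mats n" and jnf: "jordan_nf A (map (\<lambda>m. (m, 0)) \<mu>)"
    using jordan_nf_iff_ker_profile[OF _ assms] by auto
  have c: "A \<in> carrier_mat n n" using A by (simp add: strict_ut_mats_def)
  have "A ^\<^sub>m n = 0\<^sub>m n n"
    using strict_ut_pow[OF A] c by (intro eq_matI) (auto simp: trans_less_add2)
  then show "A \<in> ut_nilpotent_of_type n \<mu>"
    using c jnf strict_ut_mats_upper_triangular[OF A]
    by (auto simp: ut_nilpotent_of_type_def nilpotent_mat_def)
qed

section \<open>Adding a row and a column\<close>

definition vec_snoc :: "'a vec \<Rightarrow> 'a \<Rightarrow> 'a vec" where
  "vec_snoc x c = vec (Suc (dim_vec x)) (\<lambda>i. if i < dim_vec x then x $ i else c)"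

definition extend_mat :: "nat \<Rightarrow> 'a::zero mat \<Rightarrow> 'a vec \<Rightarrow> 'a mat" where
  "extend_mat n A v = mat (Suc n) (Suc n)
     (\<lambda>(i, j). if i < n then if j < n then A $$ (i, j) else v $ i else 0)"

lemma vec_snoc_carrier: "x \<in> carrier_vec n \<Longrightarrow> vec_snoc x c \<in> carrier_vec (Suc n)"
  by (simp add: vec_snoc_def)

lemma vec_snoc_eq_iff:
  assumes "x \<in> carrier_vec n" "y \<in> carrier_vec n"
  shows "vec_snoc x c = vec_snoc y d \<longleftrightarrow> x = y \<and> c = d"
proof
  assume eq: "vec_snoc x c = vec_snoc y d"
  have nth: "vec_snoc x c $ i = vec_snoc y d $ i" for i using eq by simp
  have "x = y"
  proof (rule eq_vecI)
    show "x $ i = y $ i" if "i < dim_vec y" for i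
      using nth[of i] assms that by (simp add: vec_snoc_def)
  qed (use assms in simp)
  moreover have "c = d" using nth[of n] assms by (simp add: vec_snoc_def)
  ultimately show "x = y \<and> c = d" ..
qed simp

lemma vec_snoc_cases:
  assumes "z \<in> carrier_vec (Suc n)"
  obtains x c where "x \<in> carrier_vec n" "z = vec_snoc x c"
proof
  show "vec n (\<lambda>i. z $ i) \<in> carrier_vec n" by simp
  show "z = vec_snoc (vec n (\<lambda>i. z $ i)) (z $ n)"
    using assms by (intro eq_vecI) (auto simp: vec_snoc_def less_Suc_eq)
qed

lemma extend_mat_carrier: "extend_mat n A v \<in> carrier_mat (Suc n) (Suc n)"
  by (simp add: extend_mat_def)

lemma extend_mat_mult_vec:
  fixes A :: "'a::comm_ring_1 mat"
  assumes A: "A \<in> carrier_mat n n" and v: "v \<in> carrier_vec n" and x: "x \<in> carrier_vec n"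
  shows "extend_mat n A v *\<^sub>v vec_snoc x c = vec_snoc (A *\<^sub>v x + c \<cdot>\<^sub>v v) 0"
proof (rule eq_vecI)
  show "dim_vec (extend_mat n A v *\<^sub>v vec_snoc x c) = dim_vec (vec_snoc (A *\<^sub>v x + c \<cdot>\<^sub>v v) 0)"
    using v by (simp add: vec_snoc_def extend_mat_def)
  fix i assume "i < dim_vec (vec_snoc (A *\<^sub>v x + c \<cdot>\<^sub>v v) 0)"
  then have i: "i < Suc n" using v by (simp add: vec_snoc_def)
  let ?a = "\<lambda>j. extend_mat n A v $$ (i, j) * vec_snoc x c $ j"
  have "(extend_mat n A v *\<^sub>v vec_snoc x c) $ i = (\<Sum>j\<in>{0..<Suc n}. ?a j)"
    using i x by (simp add: scalar_prod_def extend_mat_def vec_snoc_def)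
  also have "\<dots> = (\<Sum>j\<in>{0..<n}. ?a j) + ?a n" by simp
  also have "\<dots> = vec_snoc (A *\<^sub>v x + c \<cdot>\<^sub>v v) 0 $ i"
  proof (cases "i < n")
    case True
    have "(\<Sum>j\<in>{0..<n}. ?a j) = (\<Sum>j\<in>{0..<n}. A $$ (i, j) * x $ j)"
      using True x by (intro sum.cong) (auto simp: extend_mat_def vec_snoc_def)
    then show ?thesis
      using True A v x by (simp add: scalar_prod_def extend_mat_def vec_snoc_def mult.commute)
  next
    case False
    have "(\<Sum>j\<in>{0..<n}. ?a j) = 0"
      using False i by (intro sum.neutral) (auto simp: extend_mat_def)
    then show ?thesis
      using False i v x by (simp add: extend_mat_def vec_snoc_def)
  qed
  finally show "(extend_mat n A v *\<^sub>v vec_snoc x c) $ i = vec_snoc (A *\<^sub>v x + c \<cdot>\<^sub>v v) 0 $ i" .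
qed

lemma pow_mat_Suc_mult_vec:
  assumes "A \<in> carrier_mat n n" "x \<in> carrier_vec n"
  shows "A ^\<^sub>m Suc k *\<^sub>v x = A ^\<^sub>m k *\<^sub>v (A *\<^sub>v x)"
  unfolding pow_mat.simps
  by (rule assoc_mult_mat_vec[OF pow_carrier_mat[OF assms(1)] assms])

lemma pow_mat_Suc_mult_vec':
  assumes A: "A \<in> carrier_mat n n" and "x \<in> carrier_vec n"
  shows "A ^\<^sub>m Suc k *\<^sub>v x = A *\<^sub>v (A ^\<^sub>m k *\<^sub>v x)"
  using assms(2)
proof (induction k arbitrary: x)
  case 0
  then show ?case using A by (simp add: pow_mat_Suc_mult_vec)
next
  case (Suc k)
  have "A *\<^sub>v x \<in> carrier_vec n" using A Suc.prems by simp
  then show ?case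
    using Suc by (simp only: pow_mat_Suc_mult_vec[OF A])
qed

text \<open>The vectors with last coordinate 0 form an invariant subspace on which the extension
  acts as \<open>A\<close>.\<close>

lemma extend_mat_pow_mult_vec_0:
  fixes A :: "'a::field mat"
  assumes A: "A \<in> carrier_mat n n" and v: "v \<in> carrier_vec n" and "x \<in> carrier_vec n"
  shows "extend_mat n A v ^\<^sub>m k *\<^sub>v vec_snoc x 0 = vec_snoc (A ^\<^sub>m k *\<^sub>v x) 0"
  using assms(3)
proof (induction k arbitrary: x)
  case 0
  have "dim_row (extend_mat n A v) = Suc n" by (simp add: extend_mat_def)
  then show ?case using A 0 vec_snoc_carrier[OF 0, of 0] by simp
next
  case (Suc k)
  have Ax: "A *\<^sub>v x \<in> carrier_vec n" using A Suc.prems by simp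
  have "A *\<^sub>v x + 0 \<cdot>\<^sub>v v = A *\<^sub>v x" using A Ax v by (intro eq_vecI) auto
  then show ?case
    unfolding pow_mat_Suc_mult_vec[OF extend_mat_carrier vec_snoc_carrier[OF Suc.prems]]
      extend_mat_mult_vec[OF A v Suc.prems] pow_mat_Suc_mult_vec[OF A Suc.prems]
    using Suc.IH[OF Ax] by simp
qed

text \<open>One application sends every vector into that subspace, and the remaining
  \<open>k\<close> factors act as A^k. This is why \<open>v\<close> meets one factor fewer than
  \<open>x\<close>.\<close>

lemma extend_mat_pow_Suc_mult_vec:
  fixes A :: "'a::field mat"
  assumes A: "A \<in> carrier_mat n n" and v: "v \<in> carrier_vec n" and x: "x \<in> carrier_vec n"
  shows "extend_mat n A v ^\<^sub>m Suc k *\<^sub>v vec_snoc x c =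
    vec_snoc (A ^\<^sub>m Suc k *\<^sub>v x + c \<cdot>\<^sub>v (A ^\<^sub>m k *\<^sub>v v)) 0"
proof -
  have Ak: "A ^\<^sub>m k \<in> carrier_mat n n" by (rule pow_carrier_mat[OF A])
  have Ax: "A *\<^sub>v x \<in> carrier_vec n" using A x by simp
  have cv: "c \<cdot>\<^sub>v v \<in> carrier_vec n" using v by simp
  have "extend_mat n A v ^\<^sub>m Suc k *\<^sub>v vec_snoc x c =
      extend_mat n A v ^\<^sub>m k *\<^sub>v vec_snoc (A *\<^sub>v x + c \<cdot>\<^sub>v v) 0"
    by (simp only: pow_mat_Suc_mult_vec[OF extend_mat_carrier vec_snoc_carrier[OF x]]
        extend_mat_mult_vec[OF A v x])
  also have "\<dots> = vec_snoc (A ^\<^sub>m k *\<^sub>v (A *\<^sub>v x + c \<cdot>\<^sub>v v)) 0"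
    using Ax v by (intro extend_mat_pow_mult_vec_0[OF A v]) simp
  also have "A ^\<^sub>m k *\<^sub>v (A *\<^sub>v x + c \<cdot>\<^sub>v v) = A ^\<^sub>m Suc k *\<^sub>v x + c \<cdot>\<^sub>v (A ^\<^sub>m k *\<^sub>v v)"
    by (simp only: pow_mat_Suc_mult_vec[OF A x] mult_add_distrib_mat_vec[OF Ak Ax cv]
        mult_mat_vec[OF Ak v])
  finally show ?thesis .
qed

text \<open>The vectors \<open>v\<close> in the subspace \<open>im A + ker A\<^sup>k\<close>, described without sums of subspaces.\<close>

definition level_set :: "nat \<Rightarrow> 'a::field mat \<Rightarrow> nat \<Rightarrow> 'a vec set" where
  "level_set n A k = {v \<in> carrier_vec n. A ^\<^sub>m k *\<^sub>v v \<in> (\<lambda>x. A ^\<^sub>m Suc k *\<^sub>v x) ` carrier_vec n}"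

lemma level_set_Suc_mono:
  assumes A: "A \<in> carrier_mat n n"
  shows "level_set n A k \<subseteq> level_set n A (Suc k)"
proof
  fix v assume "v \<in> level_set n A k"
  then obtain x where vx: "v \<in> carrier_vec n" "x \<in> carrier_vec n"
    "A ^\<^sub>m k *\<^sub>v v = A ^\<^sub>m Suc k *\<^sub>v x"
    unfolding level_set_def by blast
  have "A ^\<^sub>m Suc k *\<^sub>v v = A ^\<^sub>m Suc (Suc k) *\<^sub>v x"
    using pow_mat_Suc_mult_vec'[OF A vx(1), of k] pow_mat_Suc_mult_vec'[OF A vx(2), of "Suc k"] vx(3)
    by (simp only:)
  then show "v \<in> level_set n A (Suc k)" unfolding level_set_def using vx(1,2) by blast
qed

lemma level_set_mono:
  assumes A: "A \<in> carrier_mat n n" and "k \<le> l"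
  shows "level_set n A k \<subseteq> level_set n A l"
  using lift_Suc_mono_le[of "level_set n A", OF level_set_Suc_mono[OF A] assms(2)] .

text \<open>A^k maps the level set onto the image of A^(k+1). As membership depends only on A^k v,
  the fibres are full cosets of ker A^k, and rank-nullity for A^(k+1) gives the size of the image.
  The product form avoids division.\<close>

lemma card_level_set_mult:
  fixes A :: "'a::{field, finite} mat"
  assumes A: "A \<in> carrier_mat n n"
  shows "card (level_set n A k) * card (mat_kernel (A ^\<^sub>m Suc k)) =
    CARD('a) ^ n * card (mat_kernel (A ^\<^sub>m k))"
proof -
  let ?f = "\<lambda>v. A ^\<^sub>m k *\<^sub>v v" and ?R = "(\<lambda>x. A ^\<^sub>m Suc k *\<^sub>v x) ` carrier_vec n"
  have Ak: "A ^\<^sub>m k \<in> carrier_mat n n" "A ^\<^sub>m Suc k \<in> carrier_mat n n"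
    by (rule pow_carrier_mat[OF A])+
  have image: "?f ` level_set n A k = ?R"
  proof
    show "?R \<subseteq> ?f ` level_set n A k"
    proof clarify
      fix x :: "'a vec" assume x: "x \<in> carrier_vec n"
      then have "A *\<^sub>v x \<in> carrier_vec n" using A by simp
      moreover have "?f (A *\<^sub>v x) = A ^\<^sub>m Suc k *\<^sub>v x"
        by (simp only: pow_mat_Suc_mult_vec[OF A x])
      ultimately show "A ^\<^sub>m Suc k *\<^sub>v x \<in> ?f ` level_set n A k"
        using x unfolding level_set_def by (intro image_eqI[of _ _ "A *\<^sub>v x"]) auto
    qed
  qed (auto simp: level_set_def)
  have "card (level_set n A k) = card (?f ` level_set n A k) * card (mat_kernel (A ^\<^sub>m k))"
  proof (rule card_image_mult_card_fibre)
    show "finite (level_set n A k)"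
      by (rule finite_subset[OF _ finite_carrier_vec]) (auto simp: level_set_def)
    fix y assume "y \<in> ?f ` level_set n A k"
    then obtain w where w: "w \<in> level_set n A k" "y = ?f w" by blast
    have "{x \<in> level_set n A k. ?f x = y} = {x \<in> carrier_vec n. ?f x = ?f w}"
      using w by (auto simp: level_set_def)
    moreover have "w \<in> carrier_vec n" using w(1) by (simp add: level_set_def)
    ultimately show "card {x \<in> level_set n A k. ?f x = y} = card (mat_kernel (A ^\<^sub>m k))"
      using card_mult_mat_vec_fibre[OF Ak(1)] by simp
  qed
  then show ?thesis
    using card_mat_range_mult_card_mat_kernel[OF Ak(2)] unfolding image by (simp add: ac_simps)
qed

lemma add_smult_vec_eq_0_iff:
  fixes a b :: "'a::field vec"
  assumes "a \<in> carrier_vec n" "b \<in> carrier_vec n"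
  shows "a + c \<cdot>\<^sub>v b = 0\<^sub>v n \<longleftrightarrow> a = (- c) \<cdot>\<^sub>v b"
  using assms by (auto simp: vec_eq_iff add_eq_0_iff2)

text \<open>A vector (x, c) lies in the kernel iff A^(k+1) x = -c A^k v. If \<open>v\<close> is in
  the level set, each of the q scalars c admits a coset of ker A^(k+1); otherwise only c = 0 has
  solutions.\<close>

lemma card_mat_kernel_extend_mat_pow:
  fixes A :: "'a::{field, finite} mat"
  assumes A: "A \<in> carrier_mat n n" and v: "v \<in> carrier_vec n"
  shows "card (mat_kernel (extend_mat n A v ^\<^sub>m Suc k)) =
    card (mat_kernel (A ^\<^sub>m Suc k)) * (if v \<in> level_set n A k then CARD('a) else 1)"
proof -
  let ?B = "A ^\<^sub>m Suc k" and ?y = "A ^\<^sub>m k *\<^sub>v v" and ?E = "extend_mat n A v ^\<^sub>m Suc k"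
  let ?X = "\<lambda>c. {x \<in> carrier_vec n. ?B *\<^sub>v x + c \<cdot>\<^sub>v ?y = 0\<^sub>v n}"
  have B: "?B \<in> carrier_mat n n" by (rule pow_carrier_mat[OF A])
  have y: "?y \<in> carrier_vec n" using pow_carrier_mat[OF A, of k] v by simp
  have E: "?E \<in> carrier_mat (Suc n) (Suc n)" by (rule pow_carrier_mat[OF extend_mat_carrier])
  have Bx: "?B *\<^sub>v x \<in> carrier_vec n" if "x \<in> carrier_vec n" for x using B that by simp
  have snoc0: "vec_snoc (0\<^sub>v n) (0::'a) = 0\<^sub>v (Suc n)"
    by (intro eq_vecI) (auto simp: vec_snoc_def)
  have mem: "vec_snoc x c \<in> mat_kernel ?E \<longleftrightarrow> x \<in> ?X c" if "x \<in> carrier_vec n" for x c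
    unfolding mat_kernel[OF E] mem_Collect_eq extend_mat_pow_Suc_mult_vec[OF A v that] snoc0[symmetric]
    using vec_snoc_eq_iff[of "?B *\<^sub>v x + c \<cdot>\<^sub>v ?y" n "0\<^sub>v n" 0 0] Bx[OF that] y that vec_snoc_carrier[OF that]
    by simp
  have "bij_betw (\<lambda>(c, x). vec_snoc x c) (SIGMA c:UNIV. ?X c) (mat_kernel ?E)"
  proof (rule bij_betw_imageI)
    show "inj_on (\<lambda>(c, x). vec_snoc x c) (SIGMA c:UNIV. ?X c)"
      by (rule inj_onI) (auto simp: vec_snoc_eq_iff)
    show "(\<lambda>(c, x). vec_snoc x c) ` (SIGMA c:UNIV. ?X c) = mat_kernel ?E"
    proof (intro equalityI subsetI)
      fix z assume z: "z \<in> mat_kernel ?E"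
      then obtain x c where xc: "x \<in> carrier_vec n" "z = vec_snoc x c"
        using mat_kernelD(1)[OF E] vec_snoc_cases by blast
      then show "z \<in> (\<lambda>(c, x). vec_snoc x c) ` (SIGMA c:UNIV. ?X c)"
        using z mem[OF xc(1)] by (intro image_eqI[of _ _ "(c, x)"]) auto
    qed (use mem in auto)
  qed
  then have "card (mat_kernel ?E) = card (SIGMA c:UNIV. ?X c)"
    by (simp only: bij_betw_same_card)
  also have "\<dots> = (\<Sum>c\<in>UNIV. card (?X c))"
    by (rule card_SigmaI) (auto intro: finite_subset[OF _ finite_carrier_vec])
  also have "\<dots> = card (mat_kernel ?B) * (if v \<in> level_set n A k then CARD('a) else 1)"
  proof (cases "v \<in> level_set n A k")
    case True
    then obtain w where w: "w \<in> carrier_vec n" "?y = ?B *\<^sub>v w" unfolding level_set_def by blast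
    have "card (?X c) = card (mat_kernel ?B)" for c
    proof -
      have cw: "(- c) \<cdot>\<^sub>v w \<in> carrier_vec n" using w by simp
      have "?B *\<^sub>v x + c \<cdot>\<^sub>v ?y = 0\<^sub>v n \<longleftrightarrow> ?B *\<^sub>v x = ?B *\<^sub>v ((- c) \<cdot>\<^sub>v w)" if "x \<in> carrier_vec n" for x
      proof -
        have "?B *\<^sub>v x + c \<cdot>\<^sub>v ?y = 0\<^sub>v n \<longleftrightarrow> ?B *\<^sub>v x = (- c) \<cdot>\<^sub>v ?y"
          by (rule add_smult_vec_eq_0_iff[OF Bx[OF that] y])
        then show ?thesis unfolding mult_mat_vec[OF B w(1)] w(2) .
      qed
      then have "?X c = {x \<in> carrier_vec n. ?B *\<^sub>v x = ?B *\<^sub>v ((- c) \<cdot>\<^sub>v w)}" by blast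
      then show ?thesis using card_mult_mat_vec_fibre[OF B cw] by (simp only:)
    qed
    then show ?thesis using True by (simp add: mult.commute)
  next
    case False
    \<comment> \<open>Dividing by -c would exhibit A^k v as an image under A^(k+1).\<close>
    have empty: "?X c = {}" if "c \<noteq> 0" for c
    proof (rule ccontr)
      assume "?X c \<noteq> {}"
      then obtain x where x: "x \<in> carrier_vec n" "?B *\<^sub>v x + c \<cdot>\<^sub>v ?y = 0\<^sub>v n" by blast
      have "?B *\<^sub>v x = (- c) \<cdot>\<^sub>v ?y"
        using x(2) add_smult_vec_eq_0_iff[OF Bx[OF x(1)] y] by blast
      then have "(- inverse c) \<cdot>\<^sub>v (?B *\<^sub>v x) = (- inverse c * - c) \<cdot>\<^sub>v ?y"
        by (simp only: smult_smult_assoc)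
      then have "?y = (- inverse c) \<cdot>\<^sub>v (?B *\<^sub>v x)"
        using that by simp
      then have "?y = ?B *\<^sub>v ((- inverse c) \<cdot>\<^sub>v x)" by (simp only: mult_mat_vec[OF B x(1)])
      moreover have "(- inverse c) \<cdot>\<^sub>v x \<in> carrier_vec n" using x(1) by simp
      ultimately have "?y \<in> (\<lambda>x. ?B *\<^sub>v x) ` carrier_vec n" by (rule image_eqI)
      then show False using False v unfolding level_set_def by blast
    qed
    have "card (?X c) = (if c = 0 then card (?X 0) else 0)" for c
    proof (cases "c = 0")
      case False
      then show ?thesis unfolding empty[OF False] by (simp only: card.empty if_False)
    qed simp
    then have "(\<Sum>c\<in>UNIV. card (?X c)) = (\<Sum>c\<in>(UNIV :: 'a set). if c = 0 then card (?X 0) else 0)"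
      by (rule sum.cong[OF refl])
    also have "\<dots> = card (?X 0)" by simp
    also have "?X 0 = mat_kernel ?B"
    proof -
      have "?B *\<^sub>v x + 0 \<cdot>\<^sub>v ?y = ?B *\<^sub>v x" if "x \<in> carrier_vec n" for x
        using Bx[OF that] y by (intro eq_vecI) auto
      then show ?thesis unfolding mat_kernel[OF B] by (intro Collect_cong conj_cong refl) (simp only:)
    qed
    finally show ?thesis using False by (simp only: if_False mult_1_right)
  qed
  finally show ?thesis .
qed

text \<open>Level sets are numbered by the power of \<open>A\<close>, with im A at level 0. The box
  therefore goes to column \<open>Suc (level n A v)\<close>.\<close>

definition level :: "nat \<Rightarrow> 'a::field mat \<Rightarrow> 'a vec \<Rightarrow> nat" where
  "level n A v = (LEAST k. v \<in> level_set n A k)"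

text \<open>In \<open>card_level_set_mult\<close> the kernel exponents at \<open>k\<close> and
  \<open>Suc k\<close> differ by the size of column \<open>Suc k\<close>; the rest cancels.\<close>

lemma card_level_set:
  fixes A :: "'a::{field, finite} mat"
  assumes A: "A \<in> carrier_mat n n" and \<mu>: "ker_profile A \<mu>" "sum_list \<mu> = n"
  shows "card (level_set n A k) = CARD('a) ^ (n - col_size \<mu> (Suc k))"
proof -
  let ?q = "CARD('a)" and ?s = "(\<Sum>m\<leftarrow>\<mu>. min k m)" and ?c = "col_size \<mu> (Suc k)"
  have q: "0 < ?q" using card_field_gt_1[where 'a = 'a] by simp
  have c: "?c \<le> n"
    using col_size_le_sum_list[of \<mu> "Suc k"] \<mu> by (simp add: ker_profile_def)
  have ker: "card (mat_kernel (A ^\<^sub>m i)) = ?q ^ (\<Sum>m\<leftarrow>\<mu>. min i m)" for i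
    using \<mu>(1) unfolding ker_profile_def by blast
  have "card (level_set n A k) * ?q ^ (?s + ?c) = ?q ^ n * ?q ^ ?s"
    using card_level_set_mult[OF A, of k] unfolding ker sum_list_min_Suc .
  moreover have "?q ^ n = ?q ^ (n - ?c) * ?q ^ ?c" using c by (simp add: power_add[symmetric])
  ultimately have "(card (level_set n A k) * ?q ^ ?c) * ?q ^ ?s = (?q ^ (n - ?c) * ?q ^ ?c) * ?q ^ ?s"
    by (simp only: power_add ac_simps)
  then show ?thesis using q by simp
qed

lemma level_properties:
  fixes A :: "'a::{field, finite} mat"
  assumes A: "A \<in> carrier_mat n n" and \<mu>: "ker_profile A \<mu>" "sum_list \<mu> = n"
    and v: "v \<in> carrier_vec n"
  shows "v \<in> level_set n A k \<longleftrightarrow> level n A v \<le> k" "level n A v \<le> n"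
proof -
  have "level_set n A n \<subseteq> carrier_vec n" by (auto simp: level_set_def)
  \<comment> \<open>Column \<open>Suc n\<close> is empty, so level set \<open>n\<close> is the whole
    space and the minimum defining \<open>level\<close> exists.\<close>
  moreover have "card (level_set n A n) = card (carrier_vec n :: 'a vec set)"
    unfolding card_level_set[OF A \<mu>] card_carrier_vec using col_size_eq_0[of \<mu> "Suc n"] \<mu>(2) by simp
  ultimately have "v \<in> level_set n A n" using card_subset_eq[OF finite_carrier_vec] v by blast
  then show "level n A v \<le> n" unfolding level_def by (rule Least_le)
  have "v \<in> level_set n A (level n A v)"
    unfolding level_def by (rule LeastI[of "\<lambda>k. v \<in> level_set n A k", OF \<open>v \<in> level_set n A n\<close>])
  then show "v \<in> level_set n A k \<longleftrightarrow> level n A v \<le> k"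
    using level_set_mono[OF A] unfolding level_def by (auto intro: Least_le)
qed

text \<open>At a positive level, \<open>v\<close> witnesses that two consecutive level sets differ.
  Comparing their sizes gives a strict drop between two consecutive columns of mu, which is the room
  that the box needs.\<close>

lemma can_add_box_level:
  fixes A :: "'a::{field, finite} mat"
  assumes A: "A \<in> carrier_mat n n" and \<mu>: "ker_profile A \<mu>" "sum_list \<mu> = n"
    and v: "v \<in> carrier_vec n"
  shows "can_add_box \<mu> (Suc (level n A v))"
proof (cases "level n A v")
  case 0
  then show ?thesis by (simp add: can_add_box_def)
next
  case (Suc l)
  have "v \<in> level_set n A (Suc l)" "v \<notin> level_set n A l"
    using level_properties(1)[OF A \<mu> v] Suc by auto
  moreover have "level_set n A l \<subseteq> level_set n A (Suc l)" by (rule level_set_Suc_mono[OF A])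
  moreover have "finite (level_set n A (Suc l))"
    by (rule finite_subset[OF _ finite_carrier_vec]) (auto simp: level_set_def)
  ultimately have "card (level_set n A l) < card (level_set n A (Suc l))"
    by (intro psubset_card_mono) auto
  then have "n - col_size \<mu> (Suc l) < n - col_size \<mu> (Suc (Suc l))"
    unfolding card_level_set[OF A \<mu>] using card_field_gt_1[where 'a = 'a] by simp
  then show ?thesis unfolding Suc by (intro can_add_box_if_col_size_less) auto
qed

text \<open>Passing to the extension multiplies the size of the kernel of the k-th power by q
  exactly when k exceeds the level. A box in column \<open>Suc (level n A v)\<close> increases the
  number of boxes in the first k columns for the same k.\<close>

lemma ker_profile_extend_mat:
  fixes A :: "'a::{field, finite} mat"
  assumes A: "A \<in> carrier_mat n n" and \<mu>: "ker_profile A \<mu>" "sum_list \<mu> = n"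
    and v: "v \<in> carrier_vec n"
  shows "ker_profile (extend_mat n A v) (add_box \<mu> (Suc (level n A v)))"
proof -
  have part: "is_partition \<mu>"
    and ker: "\<And>i. card (mat_kernel (A ^\<^sub>m i)) = CARD('a) ^ (\<Sum>m\<leftarrow>\<mu>. min i m)"
    using \<mu>(1) unfolding ker_profile_def by blast+
  note can = can_add_box_level[OF assms]
  have "card (mat_kernel (extend_mat n A v ^\<^sub>m k)) =
      CARD('a) ^ (\<Sum>m\<leftarrow>add_box \<mu> (Suc (level n A v)). min k m)" for k
  proof (cases k)
    case 0
    have "mat_kernel (1\<^sub>m (Suc n) :: 'a mat) = {0\<^sub>v (Suc n)}"
      by (auto simp: mat_kernel[of _ "Suc n" "Suc n"])
    then show ?thesis using 0 by (simp add: extend_mat_def)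
  next
    case (Suc l)
    show ?thesis
      unfolding Suc card_mat_kernel_extend_mat_pow[OF A v] ker sum_list_min_add_box[OF part can]
      using level_properties(1)[OF A \<mu> v, of l] by (simp add: power_add)
  qed
  then show ?thesis unfolding ker_profile_def using is_partition_add_box[OF part can] by blast
qed

section \<open>Counting strictly upper triangular matrices by type\<close>

definition ker_type :: "'a::{field, finite} mat \<Rightarrow> nat list" where
  "ker_type A = (THE \<mu>. ker_profile A \<mu>)"

lemma ker_type_eq:
  assumes "ker_profile A \<mu>"
  shows "ker_type A = \<mu>"
  unfolding ker_type_def using assms ker_profile_unique by blast

lemma strict_ut_mats_Suc:
  "strict_ut_mats (Suc n) = (\<lambda>(A, v). extend_mat n A v) ` (strict_ut_mats n \<times> carrier_vec n)"
proof (intro equalityI subsetI)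
  fix B :: "'a mat" assume B: "B \<in> strict_ut_mats (Suc n)"
  let ?A = "mat n n (\<lambda>ij. B $$ ij)" and ?v = "vec n (\<lambda>i. B $$ (i, n))"
  have "B = extend_mat n ?A ?v"
    using B by (intro eq_matI) (auto simp: strict_ut_mats_def extend_mat_def less_Suc_eq)
  moreover have "?A \<in> strict_ut_mats n"
    using B by (auto simp: strict_ut_mats_def)
  ultimately show "B \<in> (\<lambda>(A, v). extend_mat n A v) ` (strict_ut_mats n \<times> carrier_vec n)"
    by (intro image_eqI[of _ _ "(?A, ?v)"]) auto
next
  fix B :: "'a mat" assume "B \<in> (\<lambda>(A, v). extend_mat n A v) ` (strict_ut_mats n \<times> carrier_vec n)"
  then show "B \<in> strict_ut_mats (Suc n)"
    by (auto simp: strict_ut_mats_def extend_mat_def)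
qed

lemma inj_on_extend_mat:
  "inj_on (\<lambda>(A, v). extend_mat n A v) (strict_ut_mats n \<times> carrier_vec n)"
proof (rule inj_onI, clarify)
  fix A B :: "'a mat" and v w :: "'a vec"
  assume *: "A \<in> strict_ut_mats n" "B \<in> strict_ut_mats n" "v \<in> carrier_vec n" "w \<in> carrier_vec n"
    and eq: "extend_mat n A v = extend_mat n B w"
  have nth: "extend_mat n A v $$ (i, j) = extend_mat n B w $$ (i, j)" for i j using eq by simp
  have "A $$ (i, j) = B $$ (i, j)" if "i < n" "j < n" for i j
    using nth[of i j] that by (simp add: extend_mat_def)
  moreover have "v $ i = w $ i" if "i < n" for i
    using nth[of i n] that by (simp add: extend_mat_def)
  ultimately show "A = B \<and> v = w"
    using * by (auto simp: strict_ut_mats_def intro!: eq_matI eq_vecI)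
qed

lemma sum_strict_ut_mats_Suc:
  fixes F :: "'a::{field, finite} mat \<Rightarrow> int"
  shows "(\<Sum>B\<in>strict_ut_mats (Suc n). F B) =
    (\<Sum>A\<in>strict_ut_mats n. \<Sum>v\<in>carrier_vec n. F (extend_mat n A v))"
  unfolding strict_ut_mats_Suc sum.reindex[OF inj_on_extend_mat] sum.cartesian_product
  by (simp add: case_prod_beta)

lemma strict_ut_mats_0: "strict_ut_mats 0 = {0\<^sub>m 0 0}"
  by (auto simp: strict_ut_mats_def)

text \<open>The profile is built column by column instead of being taken from a Jordan form, since
  each step also shows that the partition has size \<open>n\<close>, as the counting of level sets
  requires.\<close>

lemma ker_profile_strict_ut:
  fixes A :: "'a::{field, finite} mat"
  assumes "A \<in> strict_ut_mats n"
  shows "ker_profile A (ker_type A) \<and> sum_list (ker_type A) = n"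
  using assms
proof (induction n arbitrary: A)
  case 0
  then have "A = 0\<^sub>m 0 0" by (simp add: strict_ut_mats_0)
  moreover have "ker_profile (0\<^sub>m 0 0 :: 'a mat) []"
  proof -
    have "mat_kernel ((0\<^sub>m 0 0 :: 'a mat) ^\<^sub>m k) = {0\<^sub>v 0}" for k
      using pow_carrier_mat[of "0\<^sub>m 0 0 :: 'a mat" 0 k] by (subst mat_kernel[of _ 0 0]) auto
    then show ?thesis by (simp add: ker_profile_def is_partition_def)
  qed
  ultimately show ?case using ker_type_eq by fastforce
next
  case (Suc n)
  then obtain B v where B: "B \<in> strict_ut_mats n" "v \<in> carrier_vec n" "A = extend_mat n B v"
    unfolding strict_ut_mats_Suc by auto
  have c: "B \<in> carrier_mat n n" using B(1) by (simp add: strict_ut_mats_def)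
  note IH = Suc.IH[OF B(1), THEN conjunct1] Suc.IH[OF B(1), THEN conjunct2]
  have part: "is_partition (ker_type B)" using IH(1) by (simp add: ker_profile_def)
  note prof = ker_profile_extend_mat[OF c IH B(2)]
  show ?case
    unfolding B(3) ker_type_eq[OF prof]
    using prof sum_list_add_box[OF part can_add_box_level[OF c IH B(2)]] IH(2) by simp
qed

text \<open>Telescopes, each term being q^(n-r+1) - q^(n-r). It distributes the difference of two
  consecutive level sets over the parallel edges of one column.\<close>

lemma geometric_sum_int:
  assumes "a \<le> b" "b \<le> n"
  shows "(\<Sum>r=a + 1..b. (q - 1) * q ^ (n - r)) = (q :: int) ^ (n - a) - q ^ (n - b)"
  using assms
proof (induction b rule: dec_induct)
  case (step m)
  have "n - m = Suc (n - Suc m)" using step.prems by simp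
  then have pow: "q ^ (n - m) = q * q ^ (n - Suc m)" by simp
  have "(\<Sum>r=a + 1..Suc m. (q - 1) * q ^ (n - r)) =
      (\<Sum>r=a + 1..m. (q - 1) * q ^ (n - r)) + (q - 1) * q ^ (n - Suc m)"
    using step.hyps by simp
  also have "(\<Sum>r=a + 1..m. (q - 1) * q ^ (n - r)) = q ^ (n - a) - q ^ (n - m)"
    using step by simp
  finally show ?case unfolding pow by (simp add: left_diff_distrib)
qed simp

text \<open>One step of \<open>path_sum\<close> on the matrix side: the vectors \<open>v\<close> are
  grouped by the column that receives the box.\<close>

lemma sum_extend_mat:
  fixes A :: "'a::{field, finite} mat"
  assumes A: "A \<in> strict_ut_mats n"
  shows "(\<Sum>v\<in>carrier_vec n. g (ker_type (extend_mat n A v))) =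
    (\<Sum>e\<in>out_edges (ker_type A). poly (edge_weight e) (int CARD('a)) * g (fst (snd e)))"
proof -
  let ?\<mu> = "ker_type A" and ?q = "int CARD('a)"
  have c: "A \<in> carrier_mat n n" using A by (simp add: strict_ut_mats_def)
  have \<mu>: "ker_profile A ?\<mu>" "sum_list ?\<mu> = n" using ker_profile_strict_ut[OF A] by auto
  then have part: "is_partition ?\<mu>" by (simp add: ker_profile_def)
  let ?D = "\<lambda>j. {v \<in> carrier_vec n. Suc (level n A v) = j}"
  have "v \<in> carrier_vec n" if "v \<in> level_set n A k" for v k
    using that by (simp add: level_set_def)
  then have lev: "v \<in> level_set n A k \<longleftrightarrow> v \<in> carrier_vec n \<and> level n A v \<le> k" for v k
    using level_properties(1)[OF c \<mu>] by blast
  have card_D: "int (card (?D j)) = (\<Sum>r\<in>out_labels ?\<mu> j. poly (edge_weight (?\<mu>, add_box ?\<mu> j, j, r)) ?q)"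
    if j: "j \<in> {1..Suc n}" for j
  proof (cases "j = 1")
    case True
    \<comment> \<open>Column 1 means that \<open>v\<close> lies in im A, and the q^(n - mu'_1) such
      vectors account for its single edge.\<close>
    have "v \<in> ?D 1 \<longleftrightarrow> v \<in> level_set n A 0" for v
      unfolding mem_Collect_eq lev by simp
    then have "?D 1 = level_set n A 0" by blast
    then show ?thesis
      using True card_level_set[OF c \<mu>, of 0] col_size_one[OF part] \<mu>(2)
      by (simp add: out_labels_def edge_weight_def poly_power)
  next
    case False
    \<comment> \<open>A box in column \<open>j\<close> means level \<open>j - 1\<close>, which is
      \<open>Suc l\<close>; the vectors of level at most \<open>l\<close> have to be taken
      away.\<close>
    define l where "l = j - 2"
    have l: "j = Suc (Suc l)" using j False unfolding l_def by auto
    have "v \<in> ?D j \<longleftrightarrow> v \<in> level_set n A (Suc l) - level_set n A l" for v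
      unfolding mem_Collect_eq Diff_iff lev l by linarith
    then have "?D j = level_set n A (Suc l) - level_set n A l" by blast
    moreover have "level_set n A l \<subseteq> level_set n A (Suc l)" by (rule level_set_Suc_mono[OF c])
    moreover have "finite (level_set n A (Suc l))"
      by (rule finite_subset[OF _ finite_carrier_vec]) (auto simp: level_set_def)
    ultimately have "int (card (?D j)) = int (card (level_set n A (Suc l))) - int (card (level_set n A l))"
      by (simp add: card_Diff_subset finite_subset card_mono of_nat_diff)
    also have "\<dots> = ?q ^ (n - col_size ?\<mu> j) - ?q ^ (n - col_size ?\<mu> (j - 1))"
      unfolding card_level_set[OF c \<mu>] l by simp
    also have "\<dots> = (\<Sum>r=col_size ?\<mu> j + 1..col_size ?\<mu> (j - 1). (?q - 1) * ?q ^ (n - r))"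
      using l \<mu>(2) col_size_antimono[of "j - 1" j ?\<mu>] col_size_le_sum_list[OF part, of "j - 1"]
      by (intro geometric_sum_int[symmetric]) auto
    finally show ?thesis
      using False \<mu>(2) by (simp add: out_labels_def edge_weight_def poly_power)
  qed
  have "(\<Sum>v\<in>carrier_vec n. g (ker_type (extend_mat n A v))) =
      (\<Sum>v\<in>carrier_vec n. g (add_box ?\<mu> (Suc (level n A v))))"
    using ker_type_eq[OF ker_profile_extend_mat[OF c \<mu>]] by (intro sum.cong) auto
  also have "\<dots> = (\<Sum>j\<in>{1..Suc n}. \<Sum>v\<in>?D j. g (add_box ?\<mu> (Suc (level n A v))))"
    using level_properties(2)[OF c \<mu>]
    by (intro sum.group[symmetric]) auto
  also have "\<dots> = (\<Sum>j\<in>{1..Suc n}. int (card (?D j)) * g (add_box ?\<mu> j))"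
    by (intro sum.cong) auto
  also have "\<dots> = (\<Sum>j\<in>{1..Suc n}. \<Sum>r\<in>out_labels ?\<mu> j.
      poly (edge_weight (?\<mu>, add_box ?\<mu> j, j, r)) ?q * g (add_box ?\<mu> j))"
    by (intro sum.cong refl) (simp only: card_D sum_distrib_right)
  also have "\<dots> = (\<Sum>e\<in>out_edges ?\<mu>. poly (edge_weight e) ?q * g (fst (snd e)))"
    unfolding sum_out_edges[OF part] \<mu>(2) by simp
  finally show ?thesis .
qed

theorem sum_strict_ut_mats_eq_path_sum:
  fixes g :: "nat list \<Rightarrow> int"
  shows "(\<Sum>A\<in>(strict_ut_mats n :: 'a::{field, finite} mat set). g (ker_type A)) =
    path_sum (int CARD('a)) n g"
proof (induction n arbitrary: g)
  case 0
  have "(0\<^sub>m 0 0 :: 'a mat) \<in> strict_ut_mats 0" by (simp add: strict_ut_mats_0)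
  then have "is_partition (ker_type (0\<^sub>m 0 0 :: 'a mat))" "sum_list (ker_type (0\<^sub>m 0 0 :: 'a mat)) = 0"
    using ker_profile_strict_ut unfolding ker_profile_def by blast+
  then have "ker_type (0\<^sub>m 0 0 :: 'a mat) = []"
    using length_le_sum_list[of "ker_type (0\<^sub>m 0 0 :: 'a mat)"] by (simp only: length_0_conv le_zero_eq)
  then show ?case by (simp add: strict_ut_mats_0)
next
  case (Suc n)
  show ?case
    unfolding sum_strict_ut_mats_Suc path_sum.simps Suc.IH[symmetric]
    by (intro sum.cong refl sum_extend_mat)
qed

lemma finite_strict_ut_mats: "finite (strict_ut_mats n :: 'a::{field, finite} mat set)"
  by (induction n) (simp_all add: strict_ut_mats_0 strict_ut_mats_Suc)

theorem corollary3p9: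
  fixes lam :: "nat list" and n k q :: nat
  assumes "n \<ge> 1"
    and "partition_of lam n"
    and "length lam = n - k"
    and "q = CARD('a)"
  shows "int (card (ut_nilpotent_of_type n lam :: 'a::{field, finite} mat set)) =
           (\<Sum>C\<in>placements_of_type n lam. poly (rook_weight n C) (int q))
       \<and> (\<Sum>C\<in>placements_of_type n lam. poly (rook_weight n C) (int q)) =
           (int q - 1) ^ (n - length lam) * (\<Sum>C\<in>placements_of_type n lam. int q ^ ne n C)"
proof -
  have part: "is_partition lam" using assms(2) by (simp add: partition_of_def)
  have types: "placements_of_type n lam = {C \<in> all_placements n. partition_type n C = lam}"
    unfolding placements_of_type_def Union_rook_placements by simp
  have "ker_profile A lam \<longleftrightarrow> ker_type A = lam" if "A \<in> strict_ut_mats n" for A :: "'a mat"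
    using ker_profile_strict_ut[OF that] ker_type_eq by blast
  then have eq: "(ut_nilpotent_of_type n lam :: 'a mat set) = strict_ut_mats n \<inter> {A. ker_type A = lam}"
    unfolding ut_nilpotent_of_type_eq[OF part] by blast
  have fin: "finite (strict_ut_mats n :: 'a mat set)" by (rule finite_strict_ut_mats)
  have "int (card (ut_nilpotent_of_type n lam :: 'a mat set)) =
      (\<Sum>A\<in>(strict_ut_mats n :: 'a mat set). of_bool (ker_type A = lam))"
    unfolding eq using fin by simp
  \<comment> \<open>The test function is the indicator of \<open>lam\<close>, so that only paths
    ending at \<open>lam\<close> count.\<close>
  also have "\<dots> = path_sum (int q) n (\<lambda>\<mu>. of_bool (\<mu> = lam))"
    unfolding assms(4) by (rule sum_strict_ut_mats_eq_path_sum)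
  also have "\<dots> = (\<Sum>C\<in>all_placements n. poly (rook_weight n C) (int q) * of_bool (partition_type n C = lam))"
    by (rule sum_all_placements_eq_path_sum[symmetric])
  also have "\<dots> = (\<Sum>C\<in>placements_of_type n lam. poly (rook_weight n C) (int q))"
    unfolding types by (intro sum.mono_neutral_cong_right) (auto simp: finite_all_placements)
  finally have 1: "int (card (ut_nilpotent_of_type n lam :: 'a mat set)) =
    (\<Sum>C\<in>placements_of_type n lam. poly (rook_weight n C) (int q))" .
  have "poly (rook_weight n C) (int q) = (int q - 1) ^ (n - length lam) * int q ^ ne n C"
    if C: "C \<in> placements_of_type n lam" for C
  proof -
    have "C \<in> all_placements n" "partition_type n C = lam" using C unfolding types by auto
    \<comment> \<open>All placements of type \<open>lam\<close> have the same number of rooks, so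
      the power of q - 1 leaves the sum.\<close>
    then have "card C = n - length lam" using partition_type_placement(2)[of C n] by simp
    then show ?thesis
      unfolding rook_weight_eq[OF \<open>C \<in> all_placements n\<close>] by (simp add: poly_power)
  qed
  then have 2: "(\<Sum>C\<in>placements_of_type n lam. poly (rook_weight n C) (int q)) =
      (int q - 1) ^ (n - length lam) * (\<Sum>C\<in>placements_of_type n lam. int q ^ ne n C)"
    unfolding sum_distrib_left by (intro sum.cong refl)
  show ?thesis using 1 2 by (rule conjI)
qed

end
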